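(* Let $\mathcal C$ be one of the classes $\mathcal F_\alpha$, $\mathcal M_\alpha$ or $\mathcal A_\alpha$ for some $\alpha<\omega_1$ (with $\alpha\ge 1$ in the case of $\mathcal F_\alpha$). Then: (i) any closed subspace of a $\mathcal C$ space is a $\mathcal C$ space; (ii) any closed subspace of an absolute $\mathcal C$ space is an absolute $\mathcal C$ space.
   Context: All topological spaces are Tychonoff (in particular Hausdorff). For a family of sets $\mathcal C$, $\mathcal C_\sigma$ (resp. $\mathcal C_\delta$) is the collection of all countable unions (resp. countable intersections) of elements of $\mathcal C$. An ordinal $\lambda+n$, with $\lambda$ zero or limit and $n\in\omega$, is even/odd according to the parity of $n$. Borel classes on a space $Y$: $\mathcal M_0(Y)=\mathcal A_0(Y)$ is the algebra of sets generated by the open subsets of $Y$; for $1\le\alpha<\omega_1$, $\mathcal M_\alpha(Y)=\left(\bigcup_{\beta<\alpha}(\mathcal M_\beta(Y)\cup\mathcal A_\beta(Y))\right)_\delta$ and $\mathcal A_\alpha(Y)=\left(\bigcup_{\beta<\alpha}(\mathcal M_\beta(Y)\cup\mathcal A_\beta(Y))\right)_\sigma$. $\mathcal F$-Borel classes: $\mathcal F_1(Y)$ is the family of closed subsets of $Y$; for $2\le\alpha<\omega_1$ even, $\mathcal F_\alpha(Y)=\left(\bigcup_{\beta<\alpha}\mathcal F_\beta(Y)\right)_\sigma$; for $3\le\alpha<\omega_1$ odd, $\mathcal F_\alpha(Y)=\left(\bigcup_{\beta<\alpha}\mathcal F_\beta(Y)\right)_\delta$ (here $1\le\beta<\alpha$).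 A compactification of $X$ is a compact (Hausdorff) space $cX$ containing (a homeomorphic copy of) $X$ as a dense subspace. $X$ is a $\mathcal C$ space if $X\in\mathcal C(cX)$ for some compactification $cX$ of $X$. $X$ is an absolute $\mathcal C$ space if $X\in\mathcal C(Y)$ for every Tychonoff space $Y$ in which $X$ is densely embedded. *)

theory Defs
  imports "HOL-Analysis.Analysis"
begin

section \<open>Countable ordinals\<close>

text \<open>
  The cardinal successor of the order on the naturals is a well-order of type \<open>\<omega>\<^sub>1\<close>;
  its elements serve as the ordinals below \<open>\<omega>\<^sub>1\<close>.
\<close>

lemma omega1_Card_order: "Card_order (cardSuc natLeq)"
  by (rule cardSuc_Card_order[OF natLeq_Card_order])

lemma omega1_infinite: "infinite (Field (cardSuc natLeq))"
  using cardSuc_finite[OF natLeq_Card_order] by (simp add: Field_natLeq)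

typedef omega1 = "Field (cardSuc natLeq)"
  using omega1_infinite finite.emptyI by (metis ex_in_conv)

lemma omega1_Well_order: "Well_order (cardSuc natLeq)"
  using omega1_Card_order card_order_on_well_order_on by blast

instantiation omega1 :: linorder
begin

definition less_eq_omega1 :: "omega1 \<Rightarrow> omega1 \<Rightarrow> bool"
  where "a \<le> b \<longleftrightarrow> (Rep_omega1 a, Rep_omega1 b) \<in> cardSuc natLeq"

definition less_omega1 :: "omega1 \<Rightarrow> omega1 \<Rightarrow> bool"
  where "a < b \<longleftrightarrow> a \<le> b \<and> \<not> b \<le> (a::omega1)"

instance
proof
  have wo: "refl_on (Field (cardSuc natLeq)) (cardSuc natLeq)" "trans (cardSuc natLeq)"
    "antisym (cardSuc natLeq)" "total_on (Field (cardSuc natLeq)) (cardSuc natLeq)"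
    using omega1_Well_order
    unfolding well_order_on_def linear_order_on_def partial_order_on_def preorder_on_def by auto
  fix x y z :: omega1
  show "(x < y) = (x \<le> y \<and> \<not> y \<le> x)" by (simp add: less_omega1_def)
  show refl: "x \<le> x" using wo(1) Rep_omega1 by (auto simp: less_eq_omega1_def refl_on_def)
  show "x \<le> y \<Longrightarrow> y \<le> z \<Longrightarrow> x \<le> z"
    using wo(2) unfolding less_eq_omega1_def by (meson transD)
  show "x \<le> y \<Longrightarrow> y \<le> x \<Longrightarrow> x = y"
    using wo(3) unfolding less_eq_omega1_def by (meson Rep_omega1_inject antisymD)
  show "x \<le> y \<or> y \<le> x"
    using wo(4) refl Rep_omega1[of x] Rep_omega1[of y] Rep_omega1_inject
    unfolding less_eq_omega1_def total_on_def by (metis (no_types, lifting) refl_onD wo(1))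
qed

end

instance omega1 :: wellorder
proof
  fix P :: "omega1 \<Rightarrow> bool" and a
  assume step: "\<And>x. (\<And>y. y < x \<Longrightarrow> P y) \<Longrightarrow> P x"
  have "wf (cardSuc natLeq - Id)"
    using omega1_Well_order unfolding well_order_on_def by blast
  then have "wf (inv_image (cardSuc natLeq - Id) Rep_omega1)" by (rule wf_inv_image)
  moreover have "inv_image (cardSuc natLeq - Id) Rep_omega1 = {(x, y). x < y}"
    by (auto simp: inv_image_def less_eq_omega1_def order_less_le Rep_omega1_inject)
  ultimately show "P a"
    using step by (metis (mono_tags, lifting) case_prodI mem_Collect_eq wf_induct_rule)
qed

lemma omega1_less_iff:
  "a < b \<longleftrightarrow> (Rep_omega1 a, Rep_omega1 b) \<in> cardSuc natLeq \<and> Rep_omega1 a \<noteq> Rep_omega1 b"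
  by (auto simp: less_eq_omega1_def order_less_le Rep_omega1_inject)

lemma omega1_no_max: "\<exists>b. (a::omega1) < b"
proof -
  obtain b where "b \<in> Field (cardSuc natLeq)" "Rep_omega1 a \<noteq> b" "(Rep_omega1 a, b) \<in> cardSuc natLeq"
    using infinite_Card_order_limit[OF omega1_Card_order omega1_infinite Rep_omega1] by blast
  then show ?thesis
    by (metis Abs_omega1_inverse omega1_less_iff)
qed

lemma countable_iff_card_le_natLeq:
  includes cardinal_syntax
  shows "countable A \<longleftrightarrow> |A| \<le>o natLeq"
proof -
  have "countable A \<longleftrightarrow> |A| \<le>o |UNIV :: nat set|"
    unfolding countable_def card_of_ordLeq[symmetric] by simp
  then show ?thesis
    using ordLeq_ordIso_trans[OF _ card_of_nat] ordLeq_ordIso_trans[OF _ ordIso_symmetric[OF card_of_nat]]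
    by metis
qed

lemma countable_lessThan_omega1:
  includes cardinal_syntax
  shows "countable {..<a::omega1}"
proof -
  let ?r = "cardSuc natLeq"
  let ?U = "underS ?r (Rep_omega1 a)"
  have "|?U| <o ?r"
    using card_of_underS[OF omega1_Card_order Rep_omega1] .
  then have "|?U| \<le>o natLeq"
    using cardSuc_ordLeq_ordLess[OF natLeq_Card_order card_of_Card_order] by blast
  then have "countable ?U"
    by (simp only: countable_iff_card_le_natLeq)
  moreover have "Rep_omega1 ` {..<a} \<subseteq> ?U"
    by (auto simp: underS_def omega1_less_iff)
  ultimately show ?thesis
    by (metis countable_image_inj_on countable_subset inj_on_subset Rep_omega1_inject injI top_greatest)
qed

lemma uncountable_omega1:
  includes cardinal_syntax
  shows "uncountable (UNIV :: omega1 set)"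
proof
  assume "countable (UNIV :: omega1 set)"
  then have "countable (Field (cardSuc natLeq))"
    by (metis countable_image type_definition.Rep_range type_definition_omega1)
  then have "|Field (cardSuc natLeq)| \<le>o natLeq"
    by (simp only: countable_iff_card_le_natLeq)
  then have "cardSuc natLeq \<le>o natLeq"
    using card_of_Field_ordIso[OF omega1_Card_order] ordIso_ordLeq_trans ordIso_symmetric by blast
  then show False
    using cardSuc_greater[OF natLeq_Card_order] not_ordLess_ordLeq by blast
qed

definition osuc :: "omega1 \<Rightarrow> omega1"
  where "osuc a = (LEAST b. a < b)"

instantiation omega1 :: "{zero, one}"
begin
definition zero_omega1_def: "0 = (LEAST a::omega1. True)"
definition one_omega1_def: "1 = osuc 0"
instance ..
end

definition zero_or_limit :: "omega1 \<Rightarrow> bool"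
  where "zero_or_limit l \<longleftrightarrow> (\<nexists>a. l = osuc a)"

definition even_ordinal :: "omega1 \<Rightarrow> bool"
  where "even_ordinal a \<longleftrightarrow> (\<exists>l n. zero_or_limit l \<and> a = (osuc ^^ n) l \<and> even n)"

definition odd_ordinal :: "omega1 \<Rightarrow> bool"
  where "odd_ordinal a \<longleftrightarrow> (\<exists>l n. zero_or_limit l \<and> a = (osuc ^^ n) l \<and> odd n)"

lemma zero_le_omega1 [simp]: "0 \<le> (a::omega1)"
  by (simp add: zero_omega1_def Least_le)

lemma less_osuc: "a < osuc a"
  unfolding osuc_def using omega1_no_max by (rule LeastI_ex)

lemma osuc_le_iff: "osuc a \<le> b \<longleftrightarrow> a < b"
  using less_osuc order_less_le_trans by (auto simp: osuc_def intro: Least_le)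

lemma osuc_inject [simp]: "osuc a = osuc b \<longleftrightarrow> a = b"
  by (metis less_osuc linorder_neqE osuc_le_iff order_less_le_trans less_irrefl)

lemma zero_or_limit_decomposition: "\<exists>!(l, n). zero_or_limit l \<and> a = (osuc ^^ n) l"
proof -
  have ex: "\<exists>l n. zero_or_limit l \<and> a = (osuc ^^ n) l"
  proof (induction a rule: less_induct)
    case (less a)
    show ?case
    proof (cases "zero_or_limit a")
      case True
      then show ?thesis by (intro exI[of _ a] exI[of _ 0]) simp
    next
      case False
      then obtain b where b: "a = osuc b" by (auto simp: zero_or_limit_def)
      then obtain l n where "zero_or_limit l" "b = (osuc ^^ n) l"
        using less[of b] less_osuc by blast
      then show ?thesis
        using b by (intro exI[of _ l] exI[of _ "Suc n"]) simp
    qed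
  qed
  have uniq: "l = l' \<and> n = n'"
    if "zero_or_limit l" "zero_or_limit l'" "(osuc ^^ n) l = (osuc ^^ n') l'" for l l' n n'
    using that
  proof (induction n arbitrary: n')
    case 0
    then show ?case by (cases n') (auto simp: zero_or_limit_def)
  next
    case (Suc n)
    then show ?case by (cases n') (auto simp: zero_or_limit_def)
  qed
  show ?thesis using ex uniq by (auto simp: Ex1_def) blast
qed

lemma odd_ordinal_iff: "odd_ordinal a \<longleftrightarrow> \<not> even_ordinal a"
  using zero_or_limit_decomposition[of a]
  unfolding odd_ordinal_def even_ordinal_def by (auto simp: Ex1_def) blast+


section \<open>Borel and F-Borel classes\<close>

definition countable_unions :: "'a set set \<Rightarrow> 'a set set"
  where "countable_unions \<C> = Collect (countable union_of (\<lambda>S. S \<in> \<C>))"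

text \<open>Intersections are taken inside the ambient set, so that the empty one is \<open>\<Omega>\<close>.\<close>

definition countable_intersections :: "'a set \<Rightarrow> 'a set set \<Rightarrow> 'a set set"
  where "countable_intersections \<Omega> \<C> =
    Collect (countable intersection_of (\<lambda>S. S \<in> \<C>) relative_to \<Omega>)"

function mult_class :: "omega1 \<Rightarrow> 'a topology \<Rightarrow> 'a set set"
  and add_class :: "omega1 \<Rightarrow> 'a topology \<Rightarrow> 'a set set"
  where
  "mult_class \<alpha> Y =
    (if \<alpha> = 0 then algebra (topspace Y) hull {U. openin Y U}
     else countable_intersections (topspace Y) (\<Union>\<beta>\<in>{..<\<alpha>}. mult_class \<beta> Y \<union> add_class \<beta> Y))"
| "add_class \<alpha> Y =
    (if \<alpha> = 0 then algebra (topspace Y) hull {U. openin Y U}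
     else countable_unions (\<Union>\<beta>\<in>{..<\<alpha>}. mult_class \<beta> Y \<union> add_class \<beta> Y))"
  by pat_completeness auto
termination
  by (relation "inv_image {(a, b). a < b} (case_sum fst fst)") (auto simp: wf)

text \<open>
  The hierarchy starts at \<open>\<alpha> = 1\<close>; the value at \<open>0\<close> is a dummy and is not used in later stages.
\<close>

function F_class :: "omega1 \<Rightarrow> 'a topology \<Rightarrow> 'a set set"
  where
  "F_class \<alpha> Y =
    (if \<alpha> = 0 then {}
     else if \<alpha> = 1 then {S. closedin Y S}
     else if even_ordinal \<alpha> then countable_unions (\<Union>\<beta>\<in>{1..<\<alpha>}. F_class \<beta> Y)
     else countable_intersections (topspace Y) (\<Union>\<beta>\<in>{1..<\<alpha>}. F_class \<beta> Y))"
  by pat_completeness auto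
termination
  by (relation "inv_image {(a, b). a < b} fst") (auto simp: wf)

declare mult_class.simps [simp del] add_class.simps [simp del] F_class.simps [simp del]


section \<open>\<open>\<C>\<close> spaces and absolute \<open>\<C>\<close> spaces\<close>

definition tychonoff_space :: "'a topology \<Rightarrow> bool"
  where "tychonoff_space X \<longleftrightarrow> completely_regular_space X \<and> Hausdorff_space X"

definition dense_embedding :: "'a topology \<Rightarrow> 'b topology \<Rightarrow> ('a \<Rightarrow> 'b) \<Rightarrow> bool"
  where "dense_embedding X Y e \<longleftrightarrow>
    embedding_map X Y e \<and> Y closure_of (e ` topspace X) = topspace Y"

definition compactification :: "'a topology \<Rightarrow> 'b topology \<Rightarrow> ('a \<Rightarrow> 'b) \<Rightarrow> bool"
  where "compactification X Y e \<longleftrightarrow>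
    compact_space Y \<and> Hausdorff_space Y \<and> dense_embedding X Y e"

text \<open>
  The two notions below quantify over all spaces \<open>Y\<close> in which \<open>X\<close> is densely embedded. As HOL
  cannot quantify over types, \<open>Y\<close> ranges over the topologies on \<open>'a set set\<close>. This is no
  restriction: a Hausdorff space with a dense copy of \<open>X\<close> has at most \<open>2 ^ 2 ^ |X|\<close> points and hence
  is homeomorphic to such a topology; see the lemmas at the end of this theory, which
  carry both notions over to spaces \<open>Y\<close> on arbitrary types.
\<close>

definition C_space :: "('a set set topology \<Rightarrow> 'a set set set set) \<Rightarrow> 'a topology \<Rightarrow> bool"
  where "C_space \<C> X \<longleftrightarrow>
    (\<exists>Y e. compactification X Y e \<and> e ` topspace X \<in> \<C> Y)"

definition absolute_C_space :: "('a set set topology \<Rightarrow> 'a set set set set) \<Rightarrow> 'a topology \<Rightarrow> bool"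
  where "absolute_C_space \<C> X \<longleftrightarrow>
    (\<forall>Y e. tychonoff_space Y \<and> dense_embedding X Y e \<longrightarrow> e ` topspace X \<in> \<C> Y)"


section \<open>Independence of the type carrying the ambient space\<close>

lemma dense_embedding_homeomorphic_copy:
  fixes X :: "'a topology" and Y :: "'b topology"
  assumes "Hausdorff_space Y" "dense_embedding X Y e"
  shows "\<exists>(Y' :: 'a set set topology) h. homeomorphic_map Y Y' h"
proof -
  define g where "g y = {A. A \<subseteq> topspace X \<and> y \<in> Y closure_of (e ` A)}" for y
  have dense: "Y closure_of (e ` topspace X) = topspace Y" and emb: "embedding_map X Y e"
    using assms(2) by (auto simp: dense_embedding_def)
  have inj: "inj_on g (topspace Y)"
  proof (rule inj_onI, rule ccontr)
    fix y z assume yz: "y \<in> topspace Y" "z \<in> topspace Y" "g y = g z" "y \<noteq> z"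
    then obtain U V where UV: "openin Y U" "openin Y V" "y \<in> U" "z \<in> V" "disjnt U V"
      using assms(1) by (metis Hausdorff_space_def)
    let ?A = "{x \<in> topspace X. e x \<in> U}"
    have im: "e ` ?A = U \<inter> e ` topspace X" by auto
    have "y \<in> Y closure_of (e ` ?A)"
      unfolding im using openin_Int_closure_of_subset[OF UV(1), of "e ` topspace X"] dense yz(1) UV(3)
      by auto
    then have "?A \<in> g y" by (auto simp: g_def)
    then have "z \<in> Y closure_of (e ` ?A)" using yz(3) by (auto simp: g_def)
    then show False
      using UV unfolding im in_closure_of disjnt_def by blast
  qed
  let ?f = "inv_into (topspace Y) g"
  let ?Y' = "pullback_topology (g ` topspace Y) ?f Y"
  have ts: "topspace ?Y' = g ` topspace Y"
    using inj by (auto simp: topspace_pullback_topology)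
  have "homeomorphic_maps Y ?Y' g ?f"
    unfolding homeomorphic_maps_def
  proof (intro conjI)
    have "continuous_map Y Y (?f \<circ> g)"
      by (rule continuous_map_eq[OF continuous_map_id]) (use inj in auto)
    then show "continuous_map Y ?Y' g"
      by (intro continuous_map_pullback') auto
    have "continuous_map ?Y' Y (id \<circ> ?f)"
      by (intro continuous_map_pullback) auto
    then show "continuous_map ?Y' Y ?f" by simp
  qed (use inj ts in auto)
  then show ?thesis using homeomorphic_maps_map by blast
qed

lemma mem_countable_unions:
  "S \<in> countable_unions \<C> \<longleftrightarrow> (\<exists>\<U>. countable \<U> \<and> \<U> \<subseteq> \<C> \<and> S = \<Union>\<U>)"
  by (auto simp: countable_unions_def union_of_def)

lemma mem_countable_intersections:
  "S \<in> countable_intersections \<Omega> \<C> \<longleftrightarrow> (\<exists>\<U>. countable \<U> \<and> \<U> \<subseteq> \<C> \<and> S = \<Omega> \<inter> \<Inter>\<U>)"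
  by (auto simp: countable_intersections_def intersection_of_def relative_to_def)

lemma image_countable_unions:
  assumes "S \<in> countable_unions \<C>" "\<And>T. T \<in> \<C> \<Longrightarrow> h ` T \<in> \<D>"
  shows "h ` S \<in> countable_unions \<D>"
proof -
  obtain \<U> where "countable \<U>" "\<U> \<subseteq> \<C>" "S = \<Union>\<U>"
    using assms(1) by (auto simp: mem_countable_unions)
  then show ?thesis
    unfolding mem_countable_unions using assms(2) by (intro exI[of _ "(`) h ` \<U>"]) auto
qed

lemma image_countable_intersections:
  assumes "S \<in> countable_intersections \<Omega> \<C>" "\<And>T. T \<in> \<C> \<Longrightarrow> h ` T \<in> \<D>"
    and "inj_on h \<Omega>" "\<C> \<subseteq> Pow \<Omega>"
  shows "h ` S \<in> countable_intersections (h ` \<Omega>) \<D>"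
proof -
  obtain \<U> where \<U>: "countable \<U>" "\<U> \<subseteq> \<C>" "S = \<Omega> \<inter> \<Inter>\<U>"
    using assms(1) by (auto simp: mem_countable_intersections)
  have "h ` (\<Omega> \<inter> \<Inter>\<U>) = h ` \<Omega> \<inter> \<Inter>((`) h ` \<U>)"
  proof (intro equalityI subsetI)
    fix y assume y: "y \<in> h ` \<Omega> \<inter> \<Inter>((`) h ` \<U>)"
    then obtain x where x: "x \<in> \<Omega>" "y = h x" by auto
    have "x \<in> T" if "T \<in> \<U>" for T
    proof -
      have "h x \<in> h ` T" using y x that by auto
      moreover have "T \<subseteq> \<Omega>" using that \<U>(2) assms(4) by auto
      ultimately show ?thesis using inj_on_image_mem_iff[OF assms(3) x(1)] by blast
    qed
    then show "y \<in> h ` (\<Omega> \<inter> \<Inter>\<U>)" using x by auto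
  qed auto
  then show ?thesis
    unfolding mem_countable_intersections using \<U> assms(2) by (intro exI[of _ "(`) h ` \<U>"]) auto
qed

lemma algebra_hull_open_subset:
  "algebra (topspace Y) hull {U. openin Y U} \<subseteq> Pow (topspace Y)"
  by (rule hull_minimal) (auto simp: algebra_iff_Un dest: openin_subset)

lemma algebra_hull:
  assumes "G \<subseteq> Pow \<Omega>"
  shows "algebra \<Omega> (algebra \<Omega> hull G)"
proof -
  have "algebra \<Omega> (Pow \<Omega>)" by (auto simp: algebra_iff_Un)
  then show ?thesis
    using assms unfolding hull_def algebra_iff_Un by (auto; blast)
qed

lemma F_class_subset: "F_class \<alpha> Y \<subseteq> Pow (topspace Y)"
proof (induction \<alpha> rule: less_induct)
  case (less \<alpha>)
  have "\<Union>\<U> \<in> Pow (topspace Y)" if "\<U> \<subseteq> (\<Union>\<beta>\<in>{1..<\<alpha>}. F_class \<beta> Y)" for \<U>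
    using that less by fastforce
  then show ?case
    by (subst F_class.simps)
      (auto simp: mem_countable_unions mem_countable_intersections dest: closedin_subset, blast)
qed

lemma mult_add_class_subset:
  "mult_class \<alpha> Y \<subseteq> Pow (topspace Y) \<and> add_class \<alpha> Y \<subseteq> Pow (topspace Y)"
proof (induction \<alpha> rule: less_induct)
  case (less \<alpha>)
  have "mult_class \<alpha> Y \<subseteq> Pow (topspace Y)"
    using algebra_hull_open_subset[of Y]
    by (subst mult_class.simps) (auto simp: mem_countable_intersections)
  moreover have "add_class \<alpha> Y \<subseteq> Pow (topspace Y)"
    using algebra_hull_open_subset[of Y] less
    by (subst add_class.simps) (auto simp: mem_countable_unions, blast)
  ultimately show ?case ..
qed

lemma F_class_homeomorphic_image:
  assumes h: "homeomorphic_map Y Y' h" and "S \<in> F_class \<alpha> Y"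
  shows "h ` S \<in> F_class \<alpha> Y'"
  using assms(2)
proof (induction \<alpha> arbitrary: S rule: less_induct)
  case (less \<alpha>)
  have inj: "inj_on h (topspace Y)" and im: "h ` topspace Y = topspace Y'"
    using h by (auto simp: homeomorphic_imp_injective_map homeomorphic_imp_surjective_map)
  have IH: "h ` T \<in> (\<Union>\<beta>\<in>{1..<\<alpha>}. F_class \<beta> Y')" if "T \<in> (\<Union>\<beta>\<in>{1..<\<alpha>}. F_class \<beta> Y)" for T
    using that less.IH by fastforce
  consider "\<alpha> = 0" | "\<alpha> = 1" | "\<alpha> \<noteq> 0" "\<alpha> \<noteq> 1" "even_ordinal \<alpha>" | "\<alpha> \<noteq> 0" "\<alpha> \<noteq> 1" "\<not> even_ordinal \<alpha>"
    by blast
  then show ?case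
  proof cases
    case 1
    then show ?thesis using less.prems by (simp add: F_class.simps)
  next
    case 2
    then show ?thesis
      using less.prems h homeomorphic_map_closedness[OF h] closedin_subset
      by (auto simp: F_class.simps[of 1] split: if_splits)
  next
    case 3
    then show ?thesis
      using less.prems image_countable_unions[where h=h, OF _ IH] by (simp only: F_class.simps[of \<alpha>] if_True if_False)
  next
    case 4
    have "(\<Union>\<beta>\<in>{1..<\<alpha>}. F_class \<beta> Y) \<subseteq> Pow (topspace Y)"
      using F_class_subset by blast
    then show ?thesis
      using 4 less.prems image_countable_intersections[OF _ IH inj]
      by (simp only: F_class.simps[of \<alpha>] im if_False)
  qed
qed

lemma algebra_hull_homeomorphic_image:
  assumes h: "homeomorphic_map Y Y' h" and S: "S \<in> algebra (topspace Y) hull {U. openin Y U}"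
  shows "h ` S \<in> algebra (topspace Y') hull {U. openin Y' U}"
proof -
  let ?N = "algebra (topspace Y') hull {U. openin Y' U}"
  let ?M = "{T. T \<subseteq> topspace Y \<and> h ` T \<in> ?N}"
  have inj: "inj_on h (topspace Y)" and im: "h ` topspace Y = topspace Y'"
    using h by (auto simp: homeomorphic_imp_injective_map homeomorphic_imp_surjective_map)
  have N: "algebra (topspace Y') ?N"
    by (rule algebra_hull) (auto dest: openin_subset)
  have "h ` (topspace Y - T) = topspace Y' - h ` T" if "T \<subseteq> topspace Y" for T
    using inj_on_image_set_diff[OF inj _ that] im by auto
  then have "algebra (topspace Y) ?M"
    using N by (auto simp: algebra_iff_Un image_Un)
  moreover have "{U. openin Y U} \<subseteq> ?M"
    using homeomorphic_map_openness[OF h] hull_subset[of "{U. openin Y' U}" "algebra (topspace Y')"]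
    by (auto dest: openin_subset)
  ultimately have "algebra (topspace Y) hull {U. openin Y U} \<subseteq> ?M"
    by (intro hull_minimal)
  then show ?thesis using S by blast
qed

lemma mult_add_class_homeomorphic_image:
  assumes h: "homeomorphic_map Y Y' h"
  shows "(\<forall>S\<in>mult_class \<alpha> Y. h ` S \<in> mult_class \<alpha> Y') \<and> (\<forall>S\<in>add_class \<alpha> Y. h ` S \<in> add_class \<alpha> Y')"
proof (induction \<alpha> rule: less_induct)
  case (less \<alpha>)
  have inj: "inj_on h (topspace Y)" and im: "h ` topspace Y = topspace Y'"
    using h by (auto simp: homeomorphic_imp_injective_map homeomorphic_imp_surjective_map)
  have IH: "h ` T \<in> (\<Union>\<beta>\<in>{..<\<alpha>}. mult_class \<beta> Y' \<union> add_class \<beta> Y')"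
    if "T \<in> (\<Union>\<beta>\<in>{..<\<alpha>}. mult_class \<beta> Y \<union> add_class \<beta> Y)" for T
    using that less.IH by blast
  have sub: "(\<Union>\<beta>\<in>{..<\<alpha>}. mult_class \<beta> Y \<union> add_class \<beta> Y) \<subseteq> Pow (topspace Y)"
    using mult_add_class_subset by blast
  show ?case
  proof (cases "\<alpha> = 0")
    case True
    then show ?thesis
      using algebra_hull_homeomorphic_image[OF h] by (simp add: mult_class.simps add_class.simps)
  next
    case False
    then show ?thesis
      unfolding mult_class.simps[of \<alpha>] add_class.simps[of \<alpha>] im[symmetric]
      using image_countable_unions[where h=h, OF _ IH] image_countable_intersections[OF _ IH inj sub]
      by (simp only: if_False) fast
  qed
qed

lemma dense_embedding_image_subset:
  assumes "dense_embedding X Y e"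
  shows "e ` topspace X \<subseteq> topspace Y"
proof -
  have "e ` topspace X = topspace (subtopology Y (e ` topspace X))"
    using assms homeomorphic_imp_surjective_map
    unfolding dense_embedding_def embedding_map_def by blast
  then show ?thesis by (metis inf_le1 topspace_subtopology)
qed

lemma dense_embedding_compose_homeomorphic:
  assumes "dense_embedding X Y e" "homeomorphic_map Y Y' h"
  shows "dense_embedding X Y' (h \<circ> e)"
proof -
  have emb: "embedding_map X Y e" and dense: "Y closure_of (e ` topspace X) = topspace Y"
    using assms(1) by (auto simp: dense_embedding_def)
  have sub: "e ` topspace X \<subseteq> topspace Y"
    using assms(1) by (rule dense_embedding_image_subset)
  have "Y' closure_of (h ` e ` topspace X) = topspace Y'"
    using homeomorphic_map_closure_of[OF assms(2) sub] dense
      homeomorphic_imp_surjective_map[OF assms(2)] by simp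
  moreover have "embedding_map X Y' (h \<circ> e)"
    using emb assms(2) embedding_map_compose surjective_embedding_map by metis
  ultimately show ?thesis by (simp add: dense_embedding_def image_comp)
qed

lemma C_spaceI_any_type:
  fixes X :: "'a topology" and Y :: "'b topology"
  assumes c: "compactification X Y e" and mem: "e ` topspace X \<in> \<D> Y"
    and img: "\<And>(Y' :: 'a set set topology) h S. homeomorphic_map Y Y' h \<Longrightarrow> S \<in> \<D> Y \<Longrightarrow> h ` S \<in> \<C> Y'"
  shows "C_space \<C> X"
proof -
  have c': "compact_space Y" "Hausdorff_space Y" "dense_embedding X Y e"
    using c by (auto simp: compactification_def)
  obtain Y' :: "'a set set topology" and h where h: "homeomorphic_map Y Y' h"
    using dense_embedding_homeomorphic_copy[OF c'(2,3)] by blast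
  then have "Y homeomorphic_space Y'" using homeomorphic_map_imp_homeomorphic_space by blast
  then have "compact_space Y'" "Hausdorff_space Y'"
    using c'(1,2) homeomorphic_compact_space homeomorphic_Hausdorff_space by blast+
  then show ?thesis
    unfolding C_space_def compactification_def
    using dense_embedding_compose_homeomorphic[OF c'(3) h] img[OF h mem]
    by (metis image_comp)
qed

lemma absolute_C_spaceD_any_type:
  fixes X :: "'a topology" and Y :: "'b topology"
  assumes "absolute_C_space \<C> X" "tychonoff_space Y" "dense_embedding X Y e"
    and "\<And>(Y' :: 'a set set topology) h S. homeomorphic_map Y' Y h \<Longrightarrow> S \<in> \<C> Y' \<Longrightarrow> h ` S \<in> \<D> Y"
  shows "e ` topspace X \<in> \<D> Y"
proof -
  obtain Y' :: "'a set set topology" and h where h: "homeomorphic_map Y Y' h"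
    using dense_embedding_homeomorphic_copy[OF _ assms(3)] assms(2)
    by (auto simp: tychonoff_space_def)
  then obtain g where g: "homeomorphic_maps Y Y' h g" by (auto simp: homeomorphic_map_maps)
  then have gm: "homeomorphic_map Y' Y g" using homeomorphic_maps_map by blast
  have "Y homeomorphic_space Y'" using h homeomorphic_map_imp_homeomorphic_space by blast
  then have "tychonoff_space Y'"
    using assms(2) homeomorphic_completely_regular_space homeomorphic_Hausdorff_space
    unfolding tychonoff_space_def by blast
  then have "(h \<circ> e) ` topspace X \<in> \<C> Y'"
    using assms(1) dense_embedding_compose_homeomorphic[OF assms(3) h]
    unfolding absolute_C_space_def by blast
  then have "g ` ((h \<circ> e) ` topspace X) \<in> \<D> Y" by (rule assms(4)[OF gm])
  moreover have "e ` topspace X \<subseteq> topspace Y"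
    using assms(3) by (rule dense_embedding_image_subset)
  then have "g ` ((h \<circ> e) ` topspace X) = e ` topspace X"
    using g unfolding homeomorphic_maps_def
    by (simp add: image_image subset_iff cong: image_cong_simp)
  ultimately show ?thesis by (simp only: image_comp)
qed

lemma C_space_F_class_any_type:
  assumes "compactification X Y e" and "e ` topspace X \<in> F_class \<alpha> Y"
  shows "C_space (F_class \<alpha>) X"
  using C_spaceI_any_type[of X Y e "F_class \<alpha>"] assms F_class_homeomorphic_image by blast

lemma C_space_mult_class_any_type:
  assumes "compactification X Y e" and "e ` topspace X \<in> mult_class \<alpha> Y"
  shows "C_space (mult_class \<alpha>) X"
  using C_spaceI_any_type[of X Y e "mult_class \<alpha>"] assms mult_add_class_homeomorphic_image by blast

lemma C_space_add_class_any_type: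
  assumes "compactification X Y e" and "e ` topspace X \<in> add_class \<alpha> Y"
  shows "C_space (add_class \<alpha>) X"
  using C_spaceI_any_type[of X Y e "add_class \<alpha>"] assms mult_add_class_homeomorphic_image by blast

lemma absolute_C_space_F_class_any_type:
  assumes "absolute_C_space (F_class \<alpha>) X" "tychonoff_space Y" "dense_embedding X Y e"
  shows "e ` topspace X \<in> F_class \<alpha> Y"
  using absolute_C_spaceD_any_type[of "F_class \<alpha>" X Y e "F_class \<alpha>"] assms
    F_class_homeomorphic_image by blast

lemma absolute_C_space_mult_class_any_type:
  assumes "absolute_C_space (mult_class \<alpha>) X" "tychonoff_space Y" "dense_embedding X Y e"
  shows "e ` topspace X \<in> mult_class \<alpha> Y"
  using absolute_C_spaceD_any_type[of "mult_class \<alpha>" X Y e "mult_class \<alpha>"] assms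
    mult_add_class_homeomorphic_image by blast

lemma absolute_C_space_add_class_any_type:
  assumes "absolute_C_space (add_class \<alpha>) X" "tychonoff_space Y" "dense_embedding X Y e"
  shows "e ` topspace X \<in> add_class \<alpha> Y"
  using absolute_C_spaceD_any_type[of "add_class \<alpha>" X Y e "add_class \<alpha>"] assms
    mult_add_class_homeomorphic_image by blast

end

theory Submission
  imports Defs
begin

text \<open>
  For spaces of class \<open>\<C>\<close>, intersect with the closure of \<open>F\<close> in a compactification.

  For the Borel classes, every \<open>\<C>\<close> space is an absolute \<open>\<C>\<close> space. Let \<open>X\<close> be embedded in a
  compact \<open>K\<close> and densely in \<open>Y\<close>, and let \<open>D\<close> be the closure of the diagonal copy of \<open>X\<close> in
  \<open>Y \<times> K\<close>. The projection of \<open>D\<close> to \<open>Y\<close> is perfect and onto, and any selection \<open>s\<close> of its fibres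
  satisfies \<open>s -` X = X\<close>. A Borel set depends on countably many open sets only, and for countably
  many open sets there is a selection pulling each of them back to the algebra generated by the
  open sets; hence \<open>X\<close> has the same class in \<open>Y\<close> as in \<open>K\<close>.

  For the \<open>\<F>\<close>-Borel classes no such absoluteness holds. But then \<open>X\<close> is Lindelof, being Souslin in
  a compact space, and therefore normal. Given a space \<open>Y\<close> in which \<open>F\<close> is dense, Tietze extensions
  produce a compactification \<open>Z\<close> of \<open>X\<close> and a continuous \<open>g : Y \<rightarrow> Z\<close> with \<open>g -` X = F\<close>.
\<close>

section \<open>Embeddings and compactifications\<close>

lemma embedding_map_imp_continuous_map:
  "embedding_map X Y f \<Longrightarrow> continuous_map X Y f"
  by (meson continuous_map_in_subtopology embedding_map_def homeomorphic_imp_continuous_map)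

lemma embedding_map_imp_inj_on:
  "embedding_map X Y f \<Longrightarrow> inj_on f (topspace X)"
  by (meson embedding_map_def homeomorphic_imp_injective_map)

lemma embedding_map_openin_preimage:
  assumes "embedding_map X Y f" "openin X U"
  obtains V where "openin Y V" "U = {x \<in> topspace X. f x \<in> V}"
proof -
  have "openin (subtopology Y (f ` topspace X)) (f ` U)"
    using assms homeomorphic_map_openness_eq unfolding embedding_map_def by blast
  then obtain V where V: "openin Y V" "f ` U = V \<inter> f ` topspace X"
    by (auto simp: openin_subtopology)
  have "U \<subseteq> topspace X" using assms(2) openin_subset by blast
  then have "U = {x \<in> topspace X. f x \<in> V}"
    using V(2) embedding_map_imp_inj_on[OF assms(1)]
    by (fastforce dest: inj_onD)
  with V that show thesis by blast
qed

lemma embedding_map_subtopology: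
  assumes "embedding_map X Y f"
  shows "embedding_map (subtopology X S) Y f"
proof -
  have "homeomorphic_map (subtopology X S)
      (subtopology (subtopology Y (f ` topspace X)) (f ` (topspace X \<inter> S))) f"
  proof (rule homeomorphic_map_subtopologies_alt)
    show "homeomorphic_map X (subtopology Y (f ` topspace X)) f"
      using assms by (simp add: embedding_map_def)
    show "f x \<in> f ` (topspace X \<inter> S) \<longleftrightarrow> x \<in> S" if "x \<in> topspace X" for x
      using that embedding_map_imp_inj_on[OF assms] by (auto dest: inj_onD)
  qed
  moreover have "f ` topspace X \<inter> f ` (topspace X \<inter> S) = f ` (topspace X \<inter> S)" by blast
  ultimately show ?thesis
    by (simp add: embedding_map_def subtopology_subtopology)
qed

text \<open>The local condition makes the image of every open set relatively open, so the
  corestriction to the image is a continuous open bijection.\<close>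

lemma embedding_mapI:
  assumes "continuous_map X Y f" "inj_on f (topspace X)"
    and nbhd: "\<And>U x. openin X U \<Longrightarrow> x \<in> U \<Longrightarrow>
      \<exists>V. openin Y V \<and> f x \<in> V \<and> {x' \<in> topspace X. f x' \<in> V} \<subseteq> U"
  shows "embedding_map X Y f"
proof -
  let ?S = "subtopology Y (f ` topspace X)"
  have "openin ?S (f ` U)" if U: "openin X U" for U
  proof (subst openin_subopen, intro ballI)
    fix y assume "y \<in> f ` U"
    then obtain x where x: "x \<in> U" "y = f x" by auto
    then obtain V where V: "openin Y V" "f x \<in> V" "{x' \<in> topspace X. f x' \<in> V} \<subseteq> U"
      using nbhd[OF U] by blast
    have "openin ?S (V \<inter> f ` topspace X)" using V(1) by (auto simp: openin_subtopology)
    moreover have "y \<in> V \<inter> f ` topspace X" using x V(2) openin_subset[OF U] by auto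
    moreover have "V \<inter> f ` topspace X \<subseteq> f ` U" using V(3) by auto
    ultimately show "\<exists>T. openin ?S T \<and> y \<in> T \<and> T \<subseteq> f ` U" by blast
  qed
  then have "open_map X ?S f" by (auto simp: open_map_def)
  moreover have "continuous_map X ?S f" using assms(1) by (auto simp: continuous_map_in_subtopology)
  moreover have "f ` topspace X = topspace ?S"
    using continuous_map_image_subset_topspace[OF assms(1)] by auto
  ultimately show ?thesis
    unfolding embedding_map_def using assms(2) bijective_open_imp_homeomorphic_map by metis
qed

lemma compactification_closure_of:
  assumes "embedding_map X T e" "compact_space T" "Hausdorff_space T"
  shows "compactification X (subtopology T (T closure_of (e ` topspace X))) e"
proof -
  let ?Z = "subtopology T (T closure_of (e ` topspace X))"
  have sub: "e ` topspace X \<subseteq> T closure_of (e ` topspace X)"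
    using continuous_map_image_subset_topspace[OF embedding_map_imp_continuous_map[OF assms(1)]]
    by (rule closure_of_subset)
  have "compact_space ?Z"
    using assms(2) by (simp add: closedin_compact_space compact_space_subtopology)
  moreover have "Hausdorff_space ?Z" using assms(3) by (simp add: Hausdorff_space_subtopology)
  moreover have "embedding_map X ?Z e" using assms(1) sub by (simp add: embedding_map_in_subtopology)
  moreover have "?Z closure_of (e ` topspace X) = topspace ?Z"
    using closure_of_subset_topspace[of T] sub by (auto simp: closure_of_subtopology Int_absorb1)
  ultimately show ?thesis by (simp add: compactification_def dense_embedding_def)
qed

lemma closed_set_trace_embedding:
  assumes "embedding_map X T e" "closedin X F" "x \<in> topspace X" "e x \<in> T closure_of (e ` F)"
  shows "x \<in> F"
proof (rule ccontr)
  assume "x \<notin> F"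
  have "openin X (topspace X - F)" using assms(2) by blast
  then obtain V where V: "openin T V" "topspace X - F = {x \<in> topspace X. e x \<in> V}"
    using embedding_map_openin_preimage[OF assms(1)] by metis
  then have "e x \<in> V" using assms(3) \<open>x \<notin> F\<close> by auto
  then obtain x' where "x' \<in> F" "e x' \<in> V" using assms(4) V(1) by (auto simp: in_closure_of)
  moreover have "F \<subseteq> topspace X" using assms(2) closedin_subset by blast
  ultimately show False using V(2) by blast
qed

text \<open>For \<open>S\<close> the complement of a neighbourhood of \<open>x\<close>, the points
  whose \<open>f\<close>-coordinate is below 1 pull back into that neighbourhood. The family
  \<open>B\<close> stays arbitrary: all functions give the Stone-Cech compactification, a smaller
  family one adapted to a closed subspace.\<close>

lemma cube_embedding:
  fixes X :: "'a topology" and B :: "('a \<Rightarrow> real) set"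
  assumes cont: "\<And>f. f \<in> B \<Longrightarrow> continuous_map X (top_of_set {0..1}) f"
    and sep: "\<And>S x. closedin X S \<Longrightarrow> x \<in> topspace X - S \<Longrightarrow> \<exists>f\<in>B. f x = 0 \<and> f ` S \<subseteq> {1}"
    and "Hausdorff_space X"
  shows "embedding_map X (product_topology (\<lambda>f. top_of_set {0..1}) B) (\<lambda>x. \<lambda>f\<in>B. f x)"
proof (rule embedding_mapI)
  let ?e = "\<lambda>x. \<lambda>f\<in>B. f x"
  show e: "continuous_map X (product_topology (\<lambda>f. top_of_set {0..1}) B) ?e"
    unfolding continuous_map_componentwise
  proof (intro conjI ballI)
    show "continuous_map X (top_of_set {0..1}) (\<lambda>x. (\<lambda>f\<in>B. f x) f)" if "f \<in> B" for f
      using cont[OF that] that by simp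
  qed auto
  show "inj_on ?e (topspace X)"
  proof (rule inj_onI, rule ccontr)
    fix x y assume xy: "x \<in> topspace X" "y \<in> topspace X" "?e x = ?e y" "x \<noteq> y"
    then obtain f where "f \<in> B" "f x = 0" "f ` {y} \<subseteq> {1}"
      using sep[of "{y}" x] closedin_Hausdorff_singleton[OF assms(3)] by blast
    moreover have "f x = f y" using fun_cong[OF xy(3), of f] \<open>f \<in> B\<close> by simp
    ultimately show False by simp
  qed
  fix U x assume U: "openin X U" "x \<in> U"
  then have "closedin X (topspace X - U)" "x \<in> topspace X - (topspace X - U)"
    using openin_subset by blast+
  then obtain f where f: "f \<in> B" "f x = 0" "f ` (topspace X - U) \<subseteq> {1}"
    using sep by blast
  let ?T = "product_topology (\<lambda>f. top_of_set {0..1::real}) B"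
  have "openin (top_of_set {0..1::real}) {0..<1}"
    using open_real_greaterThanLessThan[of "-1" 1] by (force simp: openin_open)
  moreover have "continuous_map ?T (top_of_set {0..1}) (\<lambda>z. z f)"
    using f(1) by (rule continuous_map_product_projection)
  ultimately have "openin ?T {z \<in> topspace ?T. z f \<in> {0..<1}}"
    by (rule openin_continuous_map_preimage[rotated])
  moreover have "?e x \<in> topspace ?T"
    using continuous_map_image_subset_topspace[OF e] U openin_subset[OF U(1)] by blast
  moreover have "{x' \<in> topspace X. ?e x' \<in> {z \<in> topspace ?T. z f \<in> {0..<1}}} \<subseteq> U"
    using f(1,3) by force
  ultimately show "\<exists>V. openin ?T V \<and> ?e x \<in> V \<and> {x' \<in> topspace X. ?e x' \<in> V} \<subseteq> U"
    using f(1,2) by (intro exI[of _ "{z \<in> topspace ?T. z f \<in> {0..<1}}"]) auto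
qed

lemma compact_Hausdorff_cube:
  fixes B :: "'a set"
  defines "T \<equiv> product_topology (\<lambda>_. top_of_set {0..1::real}) B"
  shows "compact_space T" "Hausdorff_space T"
  by (auto simp: T_def compact_space_product_topology Hausdorff_space_product_topology
      compact_space_subtopology Hausdorff_space_subtopology)

lemma tychonoff_compactification:
  fixes X :: "'a topology"
  assumes "tychonoff_space X"
  obtains Z :: "(('a \<Rightarrow> real) \<Rightarrow> real) topology" and e where "compactification X Z e"
proof -
  have "embedding_map X (product_topology (\<lambda>f. top_of_set {0..1::real})
      {f. continuous_map X (top_of_set {0..1}) f}) (\<lambda>x. \<lambda>f\<in>{f. continuous_map X (top_of_set {0..1}) f}. f x)"
    by (rule cube_embedding)
      (use assms in \<open>auto simp: tychonoff_space_def completely_regular_space_def\<close>)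
  then show thesis using compactification_closure_of[OF _ compact_Hausdorff_cube] that by blast
qed

section \<open>Preimages of Borel and F-Borel sets\<close>

lemma countable_unions_preimage:
  assumes "S \<in> countable_unions \<C>" "\<And>T. T \<in> \<C> \<Longrightarrow> {y \<in> W. g y \<in> T} \<in> \<D>"
  shows "{y \<in> W. g y \<in> S} \<in> countable_unions \<D>"
proof -
  obtain \<U> where "countable \<U>" "\<U> \<subseteq> \<C>" "S = \<Union>\<U>"
    using assms(1) by (auto simp: mem_countable_unions)
  then show ?thesis
    unfolding mem_countable_unions using assms(2)
    by (intro exI[of _ "(\<lambda>T. {y \<in> W. g y \<in> T}) ` \<U>"]) auto
qed

lemma countable_intersections_preimage:
  assumes "S \<in> countable_intersections \<Omega> \<C>" "\<And>T. T \<in> \<C> \<Longrightarrow> {y \<in> W. g y \<in> T} \<in> \<D>"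
    and "g ` W \<subseteq> \<Omega>"
  shows "{y \<in> W. g y \<in> S} \<in> countable_intersections W \<D>"
proof -
  obtain \<U> where "countable \<U>" "\<U> \<subseteq> \<C>" "S = \<Omega> \<inter> \<Inter>\<U>"
    using assms(1) by (auto simp: mem_countable_intersections)
  then show ?thesis
    unfolding mem_countable_intersections using assms(2,3)
    by (intro exI[of _ "(\<lambda>T. {y \<in> W. g y \<in> T}) ` \<U>"]) auto
qed

lemma F_class_continuous_preimage:
  assumes g: "continuous_map Y Z g" and "S \<in> F_class \<alpha> Z"
  shows "{y \<in> topspace Y. g y \<in> S} \<in> F_class \<alpha> Y"
  using assms(2)
proof (induction \<alpha> arbitrary: S rule: less_induct)
  case (less \<alpha>)
  let ?F = "\<lambda>Y. \<Union>\<beta>\<in>{1..<\<alpha>}. F_class \<beta> Y"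
  have IH: "{y \<in> topspace Y. g y \<in> T} \<in> ?F Y" if "T \<in> ?F Z" for T
    using that less.IH by fastforce
  have im: "g ` topspace Y \<subseteq> topspace Z"
    using g by (rule continuous_map_image_subset_topspace)
  have "\<alpha> \<noteq> 0" using less.prems by (auto simp: F_class.simps)
  then consider "\<alpha> = 1" | "\<alpha> \<noteq> 0" "\<alpha> \<noteq> 1" "even_ordinal \<alpha>" | "\<alpha> \<noteq> 0" "\<alpha> \<noteq> 1" "\<not> even_ordinal \<alpha>"
    by blast
  then show ?case
  proof cases
    case 1
    then show ?thesis
      using less.prems closedin_continuous_map_preimage[OF g]
      by (auto simp: F_class.simps[of 1] split: if_splits)
  next
    case 2
    then show ?thesis
      using less.prems countable_unions_preimage[OF _ IH]
      by (simp only: F_class.simps[of \<alpha>] if_True if_False)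
  next
    case 3
    then show ?thesis
      using less.prems countable_intersections_preimage[OF _ IH im]
      by (simp only: F_class.simps[of \<alpha>] if_False)
  qed
qed

section \<open>Dependence of Borel sets on countably many open sets\<close>

lemma mult_class_0: "mult_class 0 Y = algebra (topspace Y) hull {U. openin Y U}"
  by (simp add: mult_class.simps)

lemma algebra_mult_class_0: "algebra (topspace Y) (mult_class 0 Y)"
  unfolding mult_class_0 by (rule algebra_hull) (auto dest: openin_subset)

lemma openin_imp_mult_class_0: "openin Y U \<Longrightarrow> U \<in> mult_class 0 Y"
  unfolding mult_class_0 by (simp add: hull_inc)

text \<open>The function \<open>s\<close> is not assumed continuous: only the members of \<U> have
  to pull back to the algebra generated by the open sets. This weak demand is what a selection of a
  set-valued map can meet. \<open>Y\<close> and \<open>K\<close> may live on different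
  types.\<close>

definition determined_by ::
    "'c topology \<Rightarrow> ('b topology \<Rightarrow> 'b set set) \<Rightarrow> 'c set set \<Rightarrow> 'c set \<Rightarrow> bool"
  where "determined_by K \<D> \<U> S \<longleftrightarrow>
    (\<forall>(Y :: 'b topology) s. s ` topspace Y \<subseteq> topspace K \<and>
        (\<forall>U\<in>\<U>. {y \<in> topspace Y. s y \<in> U} \<in> mult_class 0 Y) \<longrightarrow>
      {y \<in> topspace Y. s y \<in> S} \<in> \<D> Y)"

definition countably_determined ::
    "'c topology \<Rightarrow> ('b topology \<Rightarrow> 'b set set) \<Rightarrow> 'c set \<Rightarrow> bool"
  where "countably_determined K \<D> S \<longleftrightarrow>
    (\<exists>\<U>. countable \<U> \<and> (\<forall>U\<in>\<U>. openin K U) \<and> determined_by K \<D> \<U> S)"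

lemma determined_byI:
  fixes \<D> :: "'b topology \<Rightarrow> 'b set set"
  assumes "\<And>(Y :: 'b topology) s. s ` topspace Y \<subseteq> topspace K \<Longrightarrow>
      (\<And>U. U \<in> \<U> \<Longrightarrow> {y \<in> topspace Y. s y \<in> U} \<in> mult_class 0 Y) \<Longrightarrow>
      {y \<in> topspace Y. s y \<in> S} \<in> \<D> Y"
  shows "determined_by K \<D> \<U> S"
  unfolding determined_by_def using assms by simp

lemma determined_byD:
  assumes "determined_by K \<D> \<U> S" "s ` topspace Y \<subseteq> topspace K"
    and "\<And>U. U \<in> \<U> \<Longrightarrow> {y \<in> topspace Y. s y \<in> U} \<in> mult_class 0 Y"
  shows "{y \<in> topspace Y. s y \<in> S} \<in> \<D> Y"
  using assms unfolding determined_by_def by simp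

lemma determined_by_mono:
  assumes "determined_by K \<D> \<U> S" "\<U> \<subseteq> \<V>"
  shows "determined_by K \<D> \<V> S"
proof (rule determined_byI)
  fix Y and s :: "'b \<Rightarrow> 'a"
  assume s: "s ` topspace Y \<subseteq> topspace K"
    "\<And>U. U \<in> \<V> \<Longrightarrow> {y \<in> topspace Y. s y \<in> U} \<in> mult_class 0 Y"
  show "{y \<in> topspace Y. s y \<in> S} \<in> \<D> Y"
    by (rule determined_byD[OF assms(1) s(1)]) (rule s(2)[OF subsetD[OF assms(2)]])
qed

text \<open>Enlarging a determining family keeps it determining, so the union of the countably many
  witnesses serves every member at once.\<close>

lemma countably_determined_family:
  assumes "countable \<S>" "\<And>S. S \<in> \<S> \<Longrightarrow> countably_determined K \<D> S"
  shows "\<exists>\<U>. countable \<U> \<and> (\<forall>U\<in>\<U>. openin K U) \<and> (\<forall>S\<in>\<S>. determined_by K \<D> \<U> S)"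
proof -
  have "\<forall>S\<in>\<S>. \<exists>\<U>. countable \<U> \<and> (\<forall>U\<in>\<U>. openin K U) \<and> determined_by K \<D> \<U> S"
    using assms(2) unfolding countably_determined_def by blast
  from bchoice[OF this] obtain \<V> where \<V>: "\<forall>S\<in>\<S>. countable (\<V> S) \<and>
      (\<forall>U\<in>\<V> S. openin K U) \<and> determined_by K \<D> (\<V> S) S"
    by blast
  show ?thesis
  proof (intro exI[of _ "\<Union>S\<in>\<S>. \<V> S"] conjI ballI[of \<S>])
    show "countable (\<Union>S\<in>\<S>. \<V> S)" using \<V> assms(1) by blast
    show "\<forall>U\<in>(\<Union>S\<in>\<S>. \<V> S). openin K U" using \<V> by blast
    show "determined_by K \<D> (\<Union>S\<in>\<S>. \<V> S) S" if "S \<in> \<S>" for S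
      using \<V> that by (blast intro: determined_by_mono)
  qed
qed

text \<open>Preimages under an arbitrary function commute with unions, and one countable family
  determines all the pieces.\<close>

lemma countably_determined_countable_unions:
  assumes "S \<in> countable_unions \<C>" "\<And>T. T \<in> \<C> \<Longrightarrow> countably_determined K \<D> T"
  shows "countably_determined K (\<lambda>Y. countable_unions (\<D> Y)) S"
proof -
  obtain \<S> where \<S>: "countable \<S>" "\<S> \<subseteq> \<C>" "S = \<Union>\<S>"
    using assms(1) by (auto simp: mem_countable_unions)
  have "countably_determined K \<D> T" if "T \<in> \<S>" for T using assms(2) \<S>(2) that by blast
  from countably_determined_family[OF \<S>(1) this]
  obtain \<U> where \<U>: "countable \<U>" "\<forall>U\<in>\<U>. openin K U" "\<forall>T\<in>\<S>. determined_by K \<D> \<U> T"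
    by blast
  have "S \<in> countable_unions \<S>" using \<S> by (auto simp: mem_countable_unions)
  then have "determined_by K (\<lambda>Y. countable_unions (\<D> Y)) \<U> S"
    by (intro determined_byI countable_unions_preimage determined_byD[OF bspec[OF \<U>(3)]])
  then show ?thesis using \<U>(1,2) unfolding countably_determined_def by blast
qed

lemma countably_determined_countable_intersections:
  assumes "S \<in> countable_intersections (topspace K) \<C>" "\<And>T. T \<in> \<C> \<Longrightarrow> countably_determined K \<D> T"
  shows "countably_determined K (\<lambda>Y. countable_intersections (topspace Y) (\<D> Y)) S"
proof -
  obtain \<S> where \<S>: "countable \<S>" "\<S> \<subseteq> \<C>" "S = topspace K \<inter> \<Inter>\<S>"
    using assms(1) by (auto simp: mem_countable_intersections)
  have "countably_determined K \<D> T" if "T \<in> \<S>" for T using assms(2) \<S>(2) that by blast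
  from countably_determined_family[OF \<S>(1) this]
  obtain \<U> where \<U>: "countable \<U>" "\<forall>U\<in>\<U>. openin K U" "\<forall>T\<in>\<S>. determined_by K \<D> \<U> T"
    by blast
  have "S \<in> countable_intersections (topspace K) \<S>"
    using \<S> by (auto simp: mem_countable_intersections)
  then have "determined_by K (\<lambda>Y. countable_intersections (topspace Y) (\<D> Y)) \<U> S"
    by (intro determined_byI countable_intersections_preimage determined_byD[OF bspec[OF \<U>(3)]])
  then show ?thesis using \<U>(1,2) unfolding countably_determined_def by blast
qed

text \<open>The countably determined subsets of \<open>K\<close> form an algebra, and an open set is
  determined by itself alone; minimality of the hull finishes the argument.\<close>

lemma countably_determined_mult_class_0:
  assumes "S \<in> mult_class 0 K"
  shows "countably_determined K (mult_class 0 :: 'b topology \<Rightarrow> 'b set set) S"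
proof -
  let ?D = "mult_class 0 :: 'b topology \<Rightarrow> 'b set set"
  let ?cd = "countably_determined K ?D"
  let ?M = "{S. S \<subseteq> topspace K \<and> ?cd S}"
  have algebra: "{} \<in> mult_class 0 Y" "A \<in> mult_class 0 Y \<Longrightarrow> topspace Y - A \<in> mult_class 0 Y"
      "A \<in> mult_class 0 Y \<Longrightarrow> A' \<in> mult_class 0 Y \<Longrightarrow> A \<union> A' \<in> mult_class 0 Y"
    for Y :: "'b topology" and A A'
    using algebra_mult_class_0[of Y] by (auto simp: algebra_iff_Un)
  have "?cd {}"
    unfolding countably_determined_def
    by (intro exI[of _ "{}"]) (auto intro: determined_byI simp: algebra(1))
  moreover have "?cd (topspace K - T)" if T: "?cd T" for T
  proof -
    obtain \<U> where \<U>: "countable \<U>" "\<forall>U\<in>\<U>. openin K U" "determined_by K ?D \<U> T"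
      using T unfolding countably_determined_def by blast
    have "determined_by K ?D \<U> (topspace K - T)"
    proof (rule determined_byI)
      fix Y :: "'b topology" and s
      assume s: "s ` topspace Y \<subseteq> topspace K"
        "\<And>U. U \<in> \<U> \<Longrightarrow> {y \<in> topspace Y. s y \<in> U} \<in> mult_class 0 Y"
      have "{y \<in> topspace Y. s y \<in> topspace K - T} = topspace Y - {y \<in> topspace Y. s y \<in> T}"
        using s(1) by auto
      then show "{y \<in> topspace Y. s y \<in> topspace K - T} \<in> mult_class 0 Y"
        using algebra(2)[OF determined_byD[OF \<U>(3) s]] by simp
    qed
    then show ?thesis using \<U>(1,2) unfolding countably_determined_def by blast
  qed
  moreover have "?cd (T \<union> T')" if T: "?cd T" "?cd T'" for T T'
  proof -
    have "?cd S" if "S \<in> {T, T'}" for S using T that by blast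
    from countably_determined_family[OF countable_finite[of "{T, T'}"] this]
    obtain \<U> where \<U>: "countable \<U>" "\<forall>U\<in>\<U>. openin K U"
        "\<forall>S\<in>{T, T'}. determined_by K ?D \<U> S"
      by auto
    have "determined_by K ?D \<U> (T \<union> T')"
    proof (rule determined_byI)
      fix Y :: "'b topology" and s
      assume s: "s ` topspace Y \<subseteq> topspace K"
        "\<And>U. U \<in> \<U> \<Longrightarrow> {y \<in> topspace Y. s y \<in> U} \<in> mult_class 0 Y"
      have "{y \<in> topspace Y. s y \<in> T \<union> T'} =
          {y \<in> topspace Y. s y \<in> T} \<union> {y \<in> topspace Y. s y \<in> T'}" by auto
      then show "{y \<in> topspace Y. s y \<in> T \<union> T'} \<in> mult_class 0 Y"
        using algebra(3) determined_byD[OF bspec[OF \<U>(3)] s] by simp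
    qed
    then show ?thesis using \<U>(1,2) unfolding countably_determined_def by blast
  qed
  ultimately have "algebra (topspace K) ?M"
    by (auto simp: algebra_iff_Un)
  moreover have "?cd U" if "openin K U" for U
    unfolding countably_determined_def
    by (intro exI[of _ "{U}"]) (auto intro: determined_byI simp: that)
  then have "{U. openin K U} \<subseteq> ?M" by (auto dest: openin_subset)
  ultimately have "mult_class 0 K \<subseteq> ?M" unfolding mult_class_0 by (intro hull_minimal)
  then show ?thesis using assms by blast
qed

lemma countably_determined_mono:
  assumes "countably_determined K \<D> S" "\<And>Y. \<D> Y \<subseteq> \<D>' Y"
  shows "countably_determined K \<D>' S"
  using assms unfolding countably_determined_def determined_by_def by (meson subsetD)

lemma countably_determined_mult_add_class:
  fixes K :: "'c topology"
  shows "(\<forall>S\<in>mult_class \<alpha> K. countably_determined K (mult_class \<alpha> :: 'b topology \<Rightarrow> 'b set set) S) \<and>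
   (\<forall>S\<in>add_class \<alpha> K. countably_determined K (add_class \<alpha> :: 'b topology \<Rightarrow> 'b set set) S)"
proof (induction \<alpha> rule: less_induct)
  case (less \<alpha>)
  show ?case
  proof (cases "\<alpha> = 0")
    case True
    have "add_class 0 = (mult_class 0 :: 'c topology \<Rightarrow> 'c set set)"
      by (rule ext) (simp add: mult_class.simps add_class.simps)
    moreover have "add_class 0 = (mult_class 0 :: 'b topology \<Rightarrow> 'b set set)"
      by (rule ext) (simp add: mult_class.simps add_class.simps)
    ultimately show ?thesis
      using True countably_determined_mult_class_0 by auto
  next
    case False
    \<comment> \<open>The union of the lower classes is named twice because the points of
      \<open>K\<close> and of \<open>Y\<close> have different types.\<close>
    define C where "C Y = (\<Union>\<beta>\<in>{..<\<alpha>}. mult_class \<beta> Y \<union> add_class \<beta> Y)" for Y :: "'c topology"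
    define D where "D Y = (\<Union>\<beta>\<in>{..<\<alpha>}. mult_class \<beta> Y \<union> add_class \<beta> Y)" for Y :: "'b topology"
    have IH: "countably_determined K D T" if T: "T \<in> C K" for T
    proof -
      obtain \<beta> where \<beta>: "\<beta> < \<alpha>" "T \<in> mult_class \<beta> K \<or> T \<in> add_class \<beta> K"
        using T by (auto simp: C_def)
      then have "countably_determined K (mult_class \<beta> :: 'b topology \<Rightarrow> _) T \<or>
          countably_determined K (add_class \<beta> :: 'b topology \<Rightarrow> _) T"
        using less by blast
      moreover have "mult_class \<beta> Y \<subseteq> D Y" "add_class \<beta> Y \<subseteq> D Y" for Y
        using \<beta>(1) by (auto simp: D_def)
      ultimately show ?thesis using countably_determined_mono by blast
    qed
    have "mult_class \<alpha> K = countable_intersections (topspace K) (C K)" "add_class \<alpha> K = countable_unions (C K)"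
      using False by (subst mult_class.simps add_class.simps, simp add: C_def)+
    moreover have "mult_class \<alpha> = (\<lambda>Y. countable_intersections (topspace Y) (D Y))"
        "add_class \<alpha> = (\<lambda>Y. countable_unions (D Y))"
      using False by (intro ext, subst mult_class.simps add_class.simps, simp add: D_def)+
    ultimately show ?thesis
      using countably_determined_countable_intersections[OF _ IH]
        countably_determined_countable_unions[OF _ IH] by simp
  qed
qed

text \<open>A continuous map pulls every open set back to an open set, so it is an admissible
  function for any determining family.\<close>

lemma mult_add_class_continuous_preimage:
  assumes g: "continuous_map Y Z g"
  shows "S \<in> mult_class \<alpha> Z \<Longrightarrow> {y \<in> topspace Y. g y \<in> S} \<in> mult_class \<alpha> Y"
    and "S \<in> add_class \<alpha> Z \<Longrightarrow> {y \<in> topspace Y. g y \<in> S} \<in> add_class \<alpha> Y"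
proof -
  have "{y \<in> topspace Y. g y \<in> S} \<in> \<D> Y" if S: "countably_determined Z \<D> S" for \<D>
  proof -
    have "{y \<in> topspace Y. g y \<in> U} \<in> mult_class 0 Y" if "openin Z U" for U
      using openin_continuous_map_preimage[OF g that] by (rule openin_imp_mult_class_0)
    then show ?thesis
      using S determined_byD[OF _ continuous_map_image_subset_topspace[OF g]]
      unfolding countably_determined_def by blast
  qed
  then show "S \<in> mult_class \<alpha> Z \<Longrightarrow> {y \<in> topspace Y. g y \<in> S} \<in> mult_class \<alpha> Y"
    and "S \<in> add_class \<alpha> Z \<Longrightarrow> {y \<in> topspace Y. g y \<in> S} \<in> add_class \<alpha> Y"
    using countably_determined_mult_add_class by blast+
qed

lemma C_space_closed_subspace:
  fixes X :: "'a topology" and \<C> :: "'a set set topology \<Rightarrow> 'a set set set set"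
  assumes preimage: "\<And>Y Z g S. continuous_map Y Z g \<Longrightarrow> S \<in> \<C> Z \<Longrightarrow> {y \<in> topspace Y. g y \<in> S} \<in> \<C> Y"
    and "C_space \<C> X" "closedin X F"
  shows "C_space \<C> (subtopology X F)"
proof -
  obtain Y e where c: "compactification X Y e" and mem: "e ` topspace X \<in> \<C> Y"
    using assms(2) by (auto simp: C_space_def)
  then have Y: "compact_space Y" "Hausdorff_space Y" "embedding_map X Y e"
    by (auto simp: compactification_def dense_embedding_def)
  have F: "F \<subseteq> topspace X" using assms(3) by (rule closedin_subset)
  then have tsF: "topspace (subtopology X F) = F" by auto
  let ?Z = "subtopology Y (Y closure_of (e ` F))"
  have c': "compactification (subtopology X F) ?Z e"
    using compactification_closure_of[OF embedding_map_subtopology[OF Y(3)] Y(1,2), of F]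
    by (simp only: tsF)
  have sub: "e ` F \<subseteq> topspace ?Z"
    using dense_embedding_image_subset[of "subtopology X F" ?Z e] c'
    unfolding compactification_def tsF by blast
  \<comment> \<open>Intersecting with the closure is taking the preimage under the inclusion, so
    stability under continuous preimages yields the class of the trace.\<close>
  have "continuous_map ?Z Y id" by (simp add: continuous_map_from_subtopology)
  then have "{y \<in> topspace ?Z. id y \<in> e ` topspace X} \<in> \<C> ?Z"
    using mem by (rule preimage)
  moreover have "{y \<in> topspace ?Z. id y \<in> e ` topspace X} = e ` F"
    using sub F closed_set_trace_embedding[OF Y(3) assms(3)] by auto
  ultimately show ?thesis
    unfolding C_space_def using c' by (metis tsF)
qed

section \<open>Absoluteness of the Borel classes\<close>

text \<open>
  The selection is made greedily: the fibre is cut down by the complement of each \<open>U n\<close> in turn,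
  whenever something is left. Compactness leaves a point in the end, and membership of the selected
  point in \<open>U n\<close> is decided at stage \<open>n\<close>.
\<close>

lemma usc_selection:
  fixes \<Phi> :: "'b \<Rightarrow> 'c set" and U :: "nat \<Rightarrow> 'c set"
  assumes "compact_space K"
    and nonempty: "\<And>y. y \<in> topspace Y \<Longrightarrow> \<Phi> y \<noteq> {}"
    and closed: "\<And>y. y \<in> topspace Y \<Longrightarrow> closedin K (\<Phi> y)"
    and usc: "\<And>C. closedin K C \<Longrightarrow> closedin Y {y \<in> topspace Y. \<Phi> y \<inter> C \<noteq> {}}"
    and U: "\<And>n. openin K (U n)"
  shows "\<exists>s. (\<forall>y\<in>topspace Y. s y \<in> \<Phi> y) \<and> (\<forall>n. {y \<in> topspace Y. s y \<in> U n} \<in> mult_class 0 Y)"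
proof -
  have algebra: "A \<in> mult_class 0 Y \<Longrightarrow> topspace Y - A \<in> mult_class 0 Y"
      "A \<in> mult_class 0 Y \<Longrightarrow> A' \<in> mult_class 0 Y \<Longrightarrow> A \<inter> A' \<in> mult_class 0 Y"
      "A \<in> mult_class 0 Y \<Longrightarrow> A' \<in> mult_class 0 Y \<Longrightarrow> A \<union> A' \<in> mult_class 0 Y" for A A'
    using algebra_mult_class_0[of Y, unfolded algebra_iff_Un]
      algebra_mult_class_0[of Y, unfolded algebra_iff_Int] by auto
  \<comment> \<open>\<open>R n y\<close> is what remains of the fibre over \<open>y\<close> after
    the first \<open>n\<close> cuts.\<close>
  define R where "R = rec_nat \<Phi> (\<lambda>n R y. if R y \<subseteq> U n then R y else R y - U n)"
  have R0: "R 0 = \<Phi>" and RS: "R (Suc n) y = (if R n y \<subseteq> U n then R n y else R n y - U n)" for n y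
    by (auto simp: R_def)
  have R: "closedin K (R n y) \<and> R n y \<noteq> {}" if "y \<in> topspace Y" for n y
    by (induction n) (use nonempty closed U that in \<open>auto simp: R0 RS closedin_diff\<close>)
  have dec: "decseq (\<lambda>n. R n y)" for y
    by (rule decseq_SucI) (auto simp: RS)
  have "(\<Inter>n. R n y) \<noteq> {}" if "y \<in> topspace Y" for y
    using R[OF that] dec by (intro compact_space_imp_nest[OF assms(1)]) auto
  then have "\<forall>y\<in>topspace Y. \<exists>k. k \<in> (\<Inter>n. R n y)" by blast
  from bchoice[OF this] obtain s where s: "\<forall>y\<in>topspace Y. s y \<in> (\<Inter>n. R n y)" by blast
  \<comment> \<open>The claim covers all closed \<open>C\<close> because the step for
    \<open>Suc n\<close> applies it to the complement of \<open>U n\<close> and to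
    \<open>C - U n\<close> as well as to \<open>C\<close>.\<close>
  have meets: "{y \<in> topspace Y. R n y \<inter> C \<noteq> {}} \<in> mult_class 0 Y" if "closedin K C" for n C
    using that
  proof (induction n arbitrary: C)
    case 0
    then have "closedin Y {y \<in> topspace Y. \<Phi> y \<inter> C \<noteq> {}}" by (rule usc)
    then have "openin Y (topspace Y - {y \<in> topspace Y. \<Phi> y \<inter> C \<noteq> {}})" by blast
    then have "topspace Y - (topspace Y - {y \<in> topspace Y. \<Phi> y \<inter> C \<noteq> {}}) \<in> mult_class 0 Y"
      using openin_imp_mult_class_0 algebra(1) by blast
    moreover have "topspace Y - (topspace Y - {y \<in> topspace Y. \<Phi> y \<inter> C \<noteq> {}}) =
        {y \<in> topspace Y. \<Phi> y \<inter> C \<noteq> {}}" by blast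
    ultimately show ?case by (simp only: R0)
  next
    case (Suc n)
    let ?M = "\<lambda>C. {y \<in> topspace Y. R n y \<inter> C \<noteq> {}}"
    have sub: "R n y \<subseteq> topspace K" if "y \<in> topspace Y" for y
      using R[OF that] closedin_subset by blast
    \<comment> \<open>The first set collects the points whose remainder lies inside
      \<open>U n\<close> and is left uncut; meeting \<open>C - U n\<close> already forces a
      cut.\<close>
    have "{y \<in> topspace Y. R (Suc n) y \<inter> C \<noteq> {}} =
        (topspace Y - ?M (topspace K - U n)) \<inter> ?M C \<union> ?M (C - U n)"
      using sub by (auto simp: RS)
    moreover have "closedin K (topspace K - U n)" "closedin K (C - U n)"
      using U Suc.prems by (auto simp: closedin_diff)
    ultimately show ?case
      using Suc.IH Suc.prems algebra by simp
  qed
  show ?thesis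
  proof (intro exI[of _ s] conjI ballI allI)
    show "s y \<in> \<Phi> y" if "y \<in> topspace Y" for y
      using s that R0 by (metis INT_E UNIV_I)
    fix n
    \<comment> \<open>\<open>s y\<close> lies in \<open>R (Suc n) y\<close>, which is either
      contained in \<open>U n\<close> or disjoint from it.\<close>
    have "s y \<in> U n \<longleftrightarrow> R n y \<inter> (topspace K - U n) = {}" if y: "y \<in> topspace Y" for y
    proof -
      have "s y \<in> R n y" "s y \<in> R (Suc n) y" using s y by blast+
      moreover have "R n y \<subseteq> topspace K" using R[OF y] closedin_subset by blast
      ultimately show ?thesis by (auto simp: RS split: if_splits)
    qed
    then have "{y \<in> topspace Y. s y \<in> U n} =
        topspace Y - {y \<in> topspace Y. R n y \<inter> (topspace K - U n) \<noteq> {}}"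
      by blast
    moreover have "closedin K (topspace K - U n)" using U by blast
    ultimately show "{y \<in> topspace Y. s y \<in> U n} \<in> mult_class 0 Y"
      using meets algebra by simp
  qed
qed

text \<open>The hypothesis \<open>near\<close> puts \<open>(i x, k)\<close> in the closure of the
  diagonal copy of \<open>X\<close>. If \<open>k\<close> differed from \<open>e x\<close>, disjoint
  neighbourhoods in \<open>K\<close>, one of them carried over to \<open>Y\<close> by the embedding
  \<open>i\<close>, would contradict this. It is applied a second time with the two spaces
  exchanged.\<close>

lemma graph_closure_unique:
  assumes "embedding_map X Y i" "continuous_map X K e" "Hausdorff_space K"
    and "x \<in> topspace X" "k \<in> topspace K"
    and near: "\<And>O' V. openin Y O' \<Longrightarrow> openin K V \<Longrightarrow> i x \<in> O' \<Longrightarrow> k \<in> V \<Longrightarrow>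
      \<exists>x'\<in>topspace X. i x' \<in> O' \<and> e x' \<in> V"
  shows "k = e x"
proof (rule ccontr)
  assume "k \<noteq> e x"
  moreover have "e x \<in> topspace K"
    using continuous_map_image_subset_topspace[OF assms(2)] assms(4) by blast
  ultimately obtain V W where VW: "openin K V" "openin K W" "k \<in> V" "e x \<in> W" "disjnt V W"
    using assms(3,5) unfolding Hausdorff_space_def by metis
  have "openin X {x' \<in> topspace X. e x' \<in> W}"
    using assms(2) VW(2) by (rule openin_continuous_map_preimage)
  then obtain O' where O': "openin Y O'" "{x' \<in> topspace X. e x' \<in> W} = {x' \<in> topspace X. i x' \<in> O'}"
    using embedding_map_openin_preimage[OF assms(1)] by metis
  then have "i x \<in> O'" using assms(4) VW(4) by blast
  then obtain x' where "x' \<in> topspace X" "i x' \<in> O'" "e x' \<in> V"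
    using near[OF O'(1) VW(1) _ VW(3)] by blast
  then show False using O'(2) VW(5) unfolding disjnt_iff by blast
qed

lemma countably_determined_dense_embedding_transfer:
  fixes X :: "'a topology" and Y :: "'b topology" and K :: "'c topology"
  assumes K: "compact_space K" "Hausdorff_space K" "embedding_map X K e"
    and Y: "Hausdorff_space Y" "dense_embedding X Y i"
    and cd: "countably_determined K \<D> (e ` topspace X)"
  shows "i ` topspace X \<in> \<D> Y"
proof -
  have i: "embedding_map X Y i" "Y closure_of (i ` topspace X) = topspace Y"
    using Y(2) by (auto simp: dense_embedding_def)
  have isub: "i ` topspace X \<subseteq> topspace Y" and esub: "e ` topspace X \<subseteq> topspace K"
    using continuous_map_image_subset_topspace embedding_map_imp_continuous_map i(1) K(3) by blast+
  define G where "G = (\<lambda>x. (i x, e x)) ` topspace X"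
  define D where "D = prod_topology Y K closure_of G"
  define \<Phi> where "\<Phi> y = {k. (y, k) \<in> D}" for y
  have D: "closedin (prod_topology Y K) D" by (simp add: D_def)
  then have Dsub: "D \<subseteq> topspace Y \<times> topspace K" using closedin_subset by fastforce
  have GD: "G \<subseteq> D"
    unfolding D_def by (rule closure_of_subset) (use isub esub in \<open>auto simp: G_def\<close>)
  \<comment> \<open>Projection along the compact factor \<open>K\<close> is a closed map; this is
    the upper semicontinuity of the fibre map.\<close>
  have proj: "closedin Y {y \<in> topspace Y. \<Phi> y \<inter> C \<noteq> {}}" if C: "closedin K C" for C
  proof -
    have "closedin (prod_topology Y K) (D \<inter> topspace Y \<times> C)"
      using D C by (simp add: closedin_Int closedin_prod_Times_iff)
    then have "closedin Y (fst ` (D \<inter> topspace Y \<times> C))"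
      using closed_map_fst[OF K(1)] by (auto simp: closed_map_def)
    moreover have "fst ` (D \<inter> topspace Y \<times> C) = {y \<in> topspace Y. \<Phi> y \<inter> C \<noteq> {}}"
      using Dsub by (force simp: \<Phi>_def)
    ultimately show ?thesis by simp
  qed
  \<comment> \<open>The points with nonempty fibre form a closed set containing the dense copy of
    \<open>X\<close>.\<close>
  have nonempty: "\<Phi> y \<noteq> {}" if "y \<in> topspace Y" for y
  proof -
    have "i ` topspace X \<subseteq> {y \<in> topspace Y. \<Phi> y \<inter> topspace K \<noteq> {}}"
      using GD isub esub by (force simp: \<Phi>_def G_def)
    then have "Y closure_of (i ` topspace X) \<subseteq> {y \<in> topspace Y. \<Phi> y \<inter> topspace K \<noteq> {}}"
      using closure_of_minimal proj[OF closedin_topspace] by blast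
    then show ?thesis using i(2) that by blast
  qed
  have closed: "closedin K (\<Phi> y)" if y: "y \<in> topspace Y" for y
  proof -
    have "continuous_map K (prod_topology Y K) (\<lambda>k. (y, k))"
      using y by (simp add: continuous_map_paired)
    then have "closedin K {k \<in> topspace K. (y, k) \<in> D}"
      using D by (rule closedin_continuous_map_preimage)
    moreover have "{k \<in> topspace K. (y, k) \<in> D} = \<Phi> y" using Dsub by (auto simp: \<Phi>_def)
    ultimately show ?thesis by simp
  qed
  have near: "\<exists>x'\<in>topspace X. i x' \<in> O' \<and> e x' \<in> V"
    if "k \<in> \<Phi> y" "openin Y O'" "openin K V" "y \<in> O'" "k \<in> V" for y k O' V
  proof -
    have "openin (prod_topology Y K) (O' \<times> V)" using that by (simp add: openin_prod_Times_iff)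
    moreover have "\<forall>T. (y, k) \<in> T \<and> openin (prod_topology Y K) T \<longrightarrow> (\<exists>p. p \<in> G \<and> p \<in> T)"
      using that(1) by (simp add: \<Phi>_def D_def in_closure_of)
    ultimately have "\<exists>p. p \<in> G \<and> p \<in> O' \<times> V" using that(4,5) by (metis SigmaI)
    then show ?thesis by (auto simp: G_def)
  qed
  obtain \<U> where \<U>: "countable \<U>" "\<forall>U\<in>\<U>. openin K U" "determined_by K \<D> \<U> (e ` topspace X)"
    using cd unfolding countably_determined_def by blast
  \<comment> \<open>Inserting the empty set keeps the family nonempty, so that it is exactly the
    range of a sequence of open sets.\<close>
  define U where "U = from_nat_into (insert {} \<U>)"
  have range: "range U = insert {} \<U>"
    using \<U>(1) by (simp add: U_def range_from_nat_into)
  then have "openin K (U n)" for n using \<U>(2) by (metis insertE openin_empty rangeI)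
  then have "\<exists>s. (\<forall>y\<in>topspace Y. s y \<in> \<Phi> y) \<and> (\<forall>n. {y \<in> topspace Y. s y \<in> U n} \<in> mult_class 0 Y)"
    by (intro usc_selection[OF K(1)] nonempty closed proj)
  then obtain s where s: "\<forall>y\<in>topspace Y. s y \<in> \<Phi> y" "\<forall>n. {y \<in> topspace Y. s y \<in> U n} \<in> mult_class 0 Y"
    by blast
  have "{y \<in> topspace Y. s y \<in> e ` topspace X} \<in> \<D> Y"
  proof (rule determined_byD[OF \<U>(3)])
    show "s ` topspace Y \<subseteq> topspace K" using s(1) Dsub by (auto simp: \<Phi>_def)
    show "{y \<in> topspace Y. s y \<in> V} \<in> mult_class 0 Y" if "V \<in> \<U>" for V
    proof -
      have "V \<in> range U" using range that by simp
      then show ?thesis using s(2) by auto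
    qed
  qed
  moreover have "s y \<in> e ` topspace X \<longleftrightarrow> y \<in> i ` topspace X" if y: "y \<in> topspace Y" for y
  proof
    have sy: "s y \<in> \<Phi> y" "s y \<in> topspace K" using s(1) y Dsub by (auto simp: \<Phi>_def)
    {
      assume "y \<in> i ` topspace X"
      then obtain x where x: "x \<in> topspace X" "y = i x" by blast
      have "s y = e x"
        by (rule graph_closure_unique[OF i(1) embedding_map_imp_continuous_map[OF K(3)] K(2) x(1) sy(2)])
          (use near[OF sy(1)] x(2) in blast)
      then show "s y \<in> e ` topspace X" using x(1) by blast
    }
    {
      assume "s y \<in> e ` topspace X"
      then obtain x where x: "x \<in> topspace X" "s y = e x" by blast
      \<comment> \<open>The same uniqueness with \<open>Y\<close> and \<open>K\<close> interchanged:
        it needs \<open>e\<close> to be an embedding and \<open>Y\<close> to be Hausdorff.\<close>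
      have "y = i x"
        by (rule graph_closure_unique[OF K(3) embedding_map_imp_continuous_map[OF i(1)] Y(1) x(1) y])
          (use near[OF sy(1)] x(2) in metis)
      then show "y \<in> i ` topspace X" using x(1) by blast
    }
  qed
  then have "{y \<in> topspace Y. s y \<in> e ` topspace X} = i ` topspace X" using isub by blast
  ultimately show ?thesis by simp
qed

lemma C_space_imp_absolute_C_space:
  assumes "\<And>K S. S \<in> \<C> K \<Longrightarrow> countably_determined K \<C> S" "C_space \<C> X"
  shows "absolute_C_space \<C> X"
  using assms countably_determined_dense_embedding_transfer
  unfolding C_space_def absolute_C_space_def compactification_def dense_embedding_def tychonoff_space_def
  by metis

section \<open>Souslin sets and the Lindelof property\<close>

text \<open>Projections of closed sets along the Baire space are the results of the Souslin
  operation on closed sets. In this form unions and intersections amount to recoding sequences, and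
  compactness of \<open>K\<close> acts through the other projection.\<close>

definition souslin_in :: "'a topology \<Rightarrow> 'a set \<Rightarrow> bool"
  where "souslin_in K S \<longleftrightarrow>
    (\<exists>D. closedin (prod_topology K (euclidean :: (nat \<Rightarrow> nat) topology)) D \<and> S = fst ` D)"

lemma closedin_imp_souslin_in:
  assumes "closedin K S"
  shows "souslin_in K S"
  unfolding souslin_in_def using assms
  by (intro exI[of _ "S \<times> UNIV"]) (simp add: closedin_prod_Times_iff)

lemma continuous_map_reindex:
  fixes h :: "nat \<Rightarrow> nat"
  shows "continuous_map (prod_topology K (euclidean :: (nat \<Rightarrow> nat) topology)) (prod_topology K euclidean)
    (\<lambda>(k, f). (k, \<lambda>m. f (h m)))"
proof -
  have "continuous_on UNIV (\<lambda>f :: nat \<Rightarrow> nat. \<lambda>m. f (h m))"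
    by (intro continuous_on_coordinatewise_then_product continuous_on_product_coordinates)
  then have "continuous_map (euclidean :: (nat \<Rightarrow> nat) topology) euclidean (\<lambda>f m. f (h m))"
    by simp
  then have "continuous_map (prod_topology K euclidean) euclidean
      ((\<lambda>f :: nat \<Rightarrow> nat. \<lambda>m. f (h m)) \<circ> snd)"
    by (rule continuous_map_compose[OF continuous_map_snd])
  then show ?thesis
    by (simp add: continuous_map_paired continuous_map_fst case_prod_unfold o_def)
qed

text \<open>The first entry of a sequence names an index \<open>n\<close>, and its tail is a witness
  for membership in \<open>S n\<close>.\<close>

lemma souslin_in_UN:
  assumes "\<And>n :: nat. souslin_in K (S n)"
  shows "souslin_in K (\<Union>n. S n)"
proof -
  let ?P = "prod_topology K (euclidean :: (nat \<Rightarrow> nat) topology)"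
  have "\<forall>n. \<exists>D. closedin ?P D \<and> S n = fst ` D" using assms by (simp add: souslin_in_def)
  from choice[OF this] obtain D where D: "\<forall>n. closedin ?P (D n) \<and> S n = fst ` D n" by blast
  define E where "E n = {p \<in> topspace ?P. (\<lambda>(k, f). (k, \<lambda>m. f (Suc m))) p \<in> D n}" for n
  \<comment> \<open>Lying in \<open>N n \<union> E n\<close> for every \<open>n\<close> means that
    the tail is a witness for the index \<open>f 0\<close>. Read as an implication, the choice of an
    index becomes an intersection of closed sets.\<close>
  define N where "N n = topspace K \<times> {f :: nat \<Rightarrow> nat. f 0 \<noteq> n}" for n
  have "closed {f :: nat \<Rightarrow> nat. f 0 \<noteq> n}" for n
  proof -
    have "closed ((\<lambda>f :: nat \<Rightarrow> nat. f 0) -` (- {n}))"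
      by (rule closed_vimage) (simp_all add: closed_def open_discrete)
    then show ?thesis by (simp add: vimage_def)
  qed
  then have "closedin ?P (N n)" for n
    by (simp add: N_def closedin_prod_Times_iff)
  moreover have "closedin ?P (E n)" for n
    unfolding E_def using D
    by (intro closedin_continuous_map_preimage[OF continuous_map_reindex[where h = "Suc"]]) simp
  ultimately have "closedin ?P (\<Inter>n. N n \<union> E n)"
    by (intro closedin_Inter) auto
  moreover have "(\<Union>n. S n) = fst ` (\<Inter>n. N n \<union> E n)"
  proof (intro equalityI subsetI)
    fix k assume "k \<in> (\<Union>n. S n)"
    then obtain n f where nf: "(k, f) \<in> D n" using D by force
    then have "k \<in> topspace K" using D closedin_subset by fastforce
    then have "(k, case_nat n f) \<in> (\<Inter>n. N n \<union> E n)"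
      using nf by (auto simp: N_def E_def)
    then show "k \<in> fst ` (\<Inter>n. N n \<union> E n)" by force
  next
    fix k assume "k \<in> fst ` (\<Inter>n. N n \<union> E n)"
    then obtain f where f: "(k, f) \<in> (\<Inter>n. N n \<union> E n)" by force
    then have "(k, f) \<in> N (f 0) \<union> E (f 0)" by blast
    then have "(k, \<lambda>m. f (Suc m)) \<in> D (f 0)" by (auto simp: N_def E_def)
    then show "k \<in> (\<Union>n. S n)" using D by force
  qed
  ultimately show ?thesis unfolding souslin_in_def by blast
qed

text \<open>One sequence codes a sequence of sequences by pairing, with row \<open>n\<close> a
  witness for \<open>S n\<close>.\<close>

lemma souslin_in_INT:
  assumes "\<And>n :: nat. souslin_in K (S n)"
  shows "souslin_in K (\<Inter>n. S n)"
proof -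
  let ?P = "prod_topology K (euclidean :: (nat \<Rightarrow> nat) topology)"
  have "\<forall>n. \<exists>D. closedin ?P D \<and> S n = fst ` D" using assms by (simp add: souslin_in_def)
  from choice[OF this] obtain D where D: "\<forall>n. closedin ?P (D n) \<and> S n = fst ` D n" by blast
  define E where "E n = {p \<in> topspace ?P. (\<lambda>(k, f). (k, \<lambda>m. f (prod_encode (n, m)))) p \<in> D n}" for n
  have "closedin ?P (E n)" for n
    unfolding E_def using D
    by (intro closedin_continuous_map_preimage[OF continuous_map_reindex[where h = "\<lambda>m. prod_encode (n, m)"]]) simp
  then have "closedin ?P (\<Inter>n. E n)" by (intro closedin_Inter) auto
  moreover have "(\<Inter>n. S n) = fst ` (\<Inter>n. E n)"
  proof (intro equalityI subsetI)
    fix k assume "k \<in> (\<Inter>n. S n)"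
    then have "\<forall>n. \<exists>f. (k, f) \<in> D n" using D by force
    from choice[OF this] obtain f where f: "\<forall>n. (k, f n) \<in> D n" by blast
    then have "k \<in> topspace K" using D closedin_subset by fastforce
    then have "(k, \<lambda>j. case prod_decode j of (n, m) \<Rightarrow> f n m) \<in> (\<Inter>n. E n)"
      using f by (auto simp: E_def)
    then show "k \<in> fst ` (\<Inter>n. E n)" by force
  next
    fix k assume "k \<in> fst ` (\<Inter>n. E n)"
    then obtain f where f: "(k, f) \<in> (\<Inter>n. E n)" by force
    then have "(k, \<lambda>m. f (prod_encode (n, m))) \<in> D n" for n by (auto simp: E_def)
    then have "k \<in> S n" for n using D by force
    then show "k \<in> (\<Inter>n. S n)" by blast
  qed
  ultimately show ?thesis unfolding souslin_in_def by blast
qed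

lemma F_class_imp_souslin_in:
  assumes "S \<in> F_class \<alpha> K"
  shows "souslin_in K S"
  using assms
proof (induction \<alpha> arbitrary: S rule: less_induct)
  case (less \<alpha>)
  let ?F = "\<Union>\<beta>\<in>{1..<\<alpha>}. F_class \<beta> K"
  have IH: "souslin_in K T" if "T \<in> ?F" for T
    using that less.IH by fastforce
  have "\<alpha> \<noteq> 0" using less.prems by (auto simp: F_class.simps)
  then consider "\<alpha> = 1" | "\<alpha> \<noteq> 0" "\<alpha> \<noteq> 1" "even_ordinal \<alpha>" | "\<alpha> \<noteq> 0" "\<alpha> \<noteq> 1" "\<not> even_ordinal \<alpha>"
    by blast
  then show ?case
  proof cases
    case 1
    then show ?thesis
      using less.prems closedin_imp_souslin_in by (auto simp: F_class.simps[of 1] split: if_splits)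
  next
    case 2
    then have "S \<in> countable_unions ?F"
      using less.prems by (simp only: F_class.simps[of \<alpha>] if_True if_False)
    then obtain \<U> where \<U>: "countable \<U>" "\<U> \<subseteq> ?F" "S = \<Union>\<U>"
      unfolding mem_countable_unions by blast
    define U where "U = from_nat_into (insert {} \<U>)"
    have range: "range U = insert {} \<U>" using \<U>(1) by (simp add: U_def range_from_nat_into)
    have "souslin_in K (U n)" for n
    proof -
      have "U n \<in> insert {} \<U>" using range by blast
      then show ?thesis
        using IH[OF subsetD[OF \<U>(2)]] closedin_imp_souslin_in[OF closedin_empty, of K] by (metis insertE)
    qed
    moreover have "S = (\<Union>n. U n)" by (simp add: range \<U>(3))
    ultimately show ?thesis using souslin_in_UN by metis
  next
    case 3
    then have "S \<in> countable_intersections (topspace K) ?F"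
      using less.prems by (simp only: F_class.simps[of \<alpha>] if_False)
    then obtain \<U> where \<U>: "countable \<U>" "\<U> \<subseteq> ?F" "S = topspace K \<inter> \<Inter>\<U>"
      unfolding mem_countable_intersections by blast
    \<comment> \<open>The whole space is a neutral default, which also accounts for the empty
      intersection.\<close>
    define U where "U = from_nat_into (insert (topspace K) \<U>)"
    have range: "range U = insert (topspace K) \<U>" using \<U>(1) by (simp add: U_def range_from_nat_into)
    have "souslin_in K (U n)" for n
    proof -
      have "U n \<in> insert (topspace K) \<U>" using range by blast
      then show ?thesis
        using IH[OF subsetD[OF \<U>(2)]] closedin_imp_souslin_in[OF closedin_topspace, of K] by (metis insertE)
    qed
    moreover have "S = (\<Inter>n. U n)" by (simp add: range \<U>(3))
    ultimately show ?thesis using souslin_in_INT by metis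
  qed
qed

lemma Lindelof_space_euclidean: "Lindelof_space (euclidean :: 'a::second_countable_topology topology)"
proof (rule second_countable_imp_Lindelof_space)
  obtain \<B> :: "'a set set" where "countable \<B>" "topological_basis \<B>"
    using ex_countable_basis by blast
  then show "second_countable (euclidean :: 'a topology)"
    unfolding second_countable_def by (metis open_openin topological_basis_open topological_basisE)
qed

text \<open>As \<open>K\<close> is compact, the projection of the product to the Baire space is
  proper. The Baire space is second countable, so the product is Lindelof, and the property passes
  to the closed set \<open>D\<close> and to its continuous image \<open>S\<close>.\<close>

lemma souslin_in_compact_imp_Lindelof_space:
  assumes "compact_space K" "souslin_in K S"
  shows "Lindelof_space (subtopology K S)"
proof -
  let ?P = "prod_topology K (euclidean :: (nat \<Rightarrow> nat) topology)"
  obtain D where D: "closedin ?P D" "S = fst ` D"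
    using assms(2) unfolding souslin_in_def by blast
  have "compactin ?P {p \<in> topspace ?P. snd p = f}" for f
  proof -
    have "{p \<in> topspace ?P. snd p = f} = topspace K \<times> {f}" by auto
    then show ?thesis using assms(1) by (simp add: compactin_Times compact_space_def)
  qed
  then have "proper_map ?P euclidean snd"
    using closed_map_snd[OF assms(1)] by (simp add: proper_map_def)
  then have "Lindelof_space ?P"
    using Lindelof_space_euclidean by (rule Lindelof_space_proper_map_preimage)
  then have "Lindelof_space (subtopology ?P D)"
    using D(1) by (rule Lindelof_space_closedin_subtopology)
  moreover have Dsub: "D \<subseteq> topspace ?P" using D(1) by (rule closedin_subset)
  have "continuous_map (subtopology ?P D) (subtopology K S) fst"
    unfolding continuous_map_in_subtopology
    using D(2) by (auto intro: continuous_map_from_subtopology continuous_map_fst)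
  moreover have "fst ` topspace (subtopology ?P D) = topspace (subtopology K S)"
    using Dsub D(2) by (auto simp: Int_absorb1)
  ultimately show ?thesis by (rule Lindelof_space_continuous_map_image)
qed

lemma F_class_compactification_imp_normal_space:
  assumes "compactification X Z e" "e ` topspace X \<in> F_class \<alpha> Z" "tychonoff_space X"
  shows "normal_space X"
proof -
  have Z: "compact_space Z" "embedding_map X Z e"
    using assms(1) by (auto simp: compactification_def dense_embedding_def)
  have "Lindelof_space (subtopology Z (e ` topspace X))"
    using Z(1) F_class_imp_souslin_in[OF assms(2)] by (rule souslin_in_compact_imp_Lindelof_space)
  moreover obtain g where "homeomorphic_maps X (subtopology Z (e ` topspace X)) e g"
    using Z(2) by (auto simp: embedding_map_def homeomorphic_map_maps)
  then have "homeomorphic_map (subtopology Z (e ` topspace X)) X g"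
    using homeomorphic_maps_map by blast
  then have "continuous_map (subtopology Z (e ` topspace X)) X g"
    "g ` topspace (subtopology Z (e ` topspace X)) = topspace X"
    using homeomorphic_imp_continuous_map homeomorphic_imp_surjective_map by blast+
  ultimately have "Lindelof_space X" by (rule Lindelof_space_continuous_map_image)
  moreover have "regular_space X"
    using assms(3) completely_regular_imp_regular_space unfolding tychonoff_space_def by blast
  ultimately show ?thesis using regular_Lindelof_imp_normal_space by blast
qed

section \<open>Extending compactifications of a closed subspace\<close>

lemma continuous_map_real_interval_iff:
  "continuous_map X (top_of_set {a..b}) f \<longleftrightarrow>
    continuous_map X euclideanreal f \<and> f ` topspace X \<subseteq> {a..b}"
  by (simp add: continuous_map_in_subtopology image_subset_iff_funcset)

text \<open>
  The compactification is generated by the functions on \<open>X\<close> whose restriction to \<open>F\<close> extends to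
  \<open>Y\<close>. By normality of \<open>X\<close> they separate points from closed sets, and their restrictions still
  separate the points of \<open>Y\<close>.
\<close>

lemma compactification_extending_closed_subspace:
  fixes X :: "'a topology"
  assumes X: "normal_space X" "tychonoff_space X" and F: "closedin X F"
    and Y: "tychonoff_space Y" "dense_embedding (subtopology X F) Y i"
  obtains Z :: "(('a \<Rightarrow> real) \<Rightarrow> real) topology" and e g
  where "compactification X Z e" "continuous_map Y Z g"
    "{y \<in> topspace Y. g y \<in> e ` topspace X} = i ` F"
proof -
  let ?I = "top_of_set {0..1::real}"
  have X': "completely_regular_space X" "Hausdorff_space X"
    and Y': "completely_regular_space Y" "Hausdorff_space Y"
    using X(2) Y(1) by (auto simp: tychonoff_space_def)
  have FX: "F \<subseteq> topspace X" using F by (rule closedin_subset)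
  then have tsF: "topspace (subtopology X F) = F" by auto
  have i: "embedding_map (subtopology X F) Y i" "Y closure_of (i ` F) = topspace Y"
    using Y(2) unfolding dense_embedding_def tsF by blast+
  have ic: "continuous_map (subtopology X F) Y i"
    using i(1) by (rule embedding_map_imp_continuous_map)
  have iF: "i ` F \<subseteq> topspace Y"
    using continuous_map_image_subset_topspace[OF ic] by (simp only: tsF)
  define B where "B = {f. continuous_map X ?I f \<and> (\<exists>h. continuous_map Y ?I h \<and> (\<forall>x\<in>F. h (i x) = f x))}"
  have extend: "\<exists>f. continuous_map X ?I f \<and> (\<forall>x\<in>F. f x = h (i x))" if h: "continuous_map Y ?I h" for h
  proof -
    have "continuous_map (subtopology X F) ?I (h \<circ> i)" using ic h by (rule continuous_map_compose)
    then have "continuous_map (subtopology X F) euclideanreal (h \<circ> i)" "(h \<circ> i) ` F \<subseteq> {0..1}"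
      unfolding continuous_map_real_interval_iff tsF by blast+
    then obtain f where "continuous_map X euclideanreal f" "\<And>x. x \<in> F \<Longrightarrow> f x = (h \<circ> i) x"
        "f ` topspace X \<subseteq> {0..1}"
      using Tietze_extension_closed_real_interval[OF X(1) F, of "h \<circ> i" 0 1] by auto
    then show ?thesis unfolding continuous_map_real_interval_iff by auto
  qed
  have sep: "\<exists>f\<in>B. f x = 0 \<and> f ` S \<subseteq> {1}" if S: "closedin X S" and x: "x \<in> topspace X - S" for S x
  proof (cases "x \<in> F")
    case False
    \<comment> \<open>Separating from \<open>F\<close> too makes the function constantly 1 on
      \<open>F\<close>, hence extendable to \<open>Y\<close> by a constant.\<close>
    have "closedin X (S \<union> F)" "x \<in> topspace X - (S \<union> F)" using S F x False by auto
    then obtain f where f: "continuous_map X ?I f" "f x = 0" "f ` (S \<union> F) \<subseteq> {1}"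
      using X'(1) unfolding completely_regular_space_def by blast
    have "continuous_map Y ?I (\<lambda>_. 1)" by simp
    moreover have "\<forall>x\<in>F. 1 = f x" using f(3) by auto
    ultimately have "f \<in> B" unfolding B_def using f(1) by blast
    then show ?thesis using f(2,3) by blast
  next
    case True
    have "openin (subtopology X F) (F - S)"
      using S FX by (auto simp: openin_subtopology intro!: exI[of _ "topspace X - S"])
    then obtain V where V: "openin Y V" "F - S = {x \<in> F. i x \<in> V}"
      using embedding_map_openin_preimage[OF i(1)] by (metis tsF)
    have "closedin Y (topspace Y - V)" "i x \<in> topspace Y - (topspace Y - V)"
      using V True x iF by auto
    then obtain h where h: "continuous_map Y ?I h" "h (i x) = 0" "h ` (topspace Y - V) \<subseteq> {1}"
      using Y'(1) unfolding completely_regular_space_def by blast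
    \<comment> \<open>\<open>p\<close> vanishes at \<open>x\<close> and equals 1 on
      \<open>F \<inter> S\<close>, but is uncontrolled on the rest of \<open>S\<close>. The part
      \<open>C\<close> of \<open>S\<close> where it is at most 1/2 misses \<open>F\<close>, so a
      Urysohn function \<open>q\<close> can correct it there.\<close>
    obtain p where p: "continuous_map X ?I p" "\<forall>x\<in>F. p x = h (i x)"
      using extend[OF h(1)] by blast
    have pc: "continuous_map X euclideanreal p" using p(1) unfolding continuous_map_real_interval_iff by blast
    have "closedin X {z \<in> topspace X. p z \<in> {..1/2}}"
      using pc by (rule closedin_continuous_map_preimage) simp
    moreover define C where "C = S \<inter> {z \<in> topspace X. p z \<in> {..1/2}}"
    ultimately have C1: "closedin X C" using S by (simp only: closedin_Int)
    have C2: "disjnt F C"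
    proof -
      have "p z = 1" if "z \<in> F" "z \<in> S" for z
      proof -
        have "i z \<in> topspace Y - V" using that V(2) iF by blast
        then show ?thesis using that(1) h(3) p(2) by auto
      qed
      then show ?thesis by (force simp: C_def disjnt_iff)
    qed
    have "\<exists>q. continuous_map X ?I q \<and> q ` F \<subseteq> {0} \<and> q ` C \<subseteq> {1}"
      using X(1)[unfolded normal_space_iff_Urysohn, rule_format, of F C] F C1 C2 by simp
    then obtain q where q: "continuous_map X ?I q" "q ` F \<subseteq> {0}" "q ` C \<subseteq> {1}"
      by (elim exE conjE)
    have qc: "continuous_map X euclideanreal q" and q01: "q ` topspace X \<subseteq> {0..1}"
      using q(1) unfolding continuous_map_real_interval_iff by blast+
    have hc: "continuous_map Y euclideanreal h" and h01: "h ` topspace Y \<subseteq> {0..1}"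
      using h(1) unfolding continuous_map_real_interval_iff by blast+
    \<comment> \<open>On \<open>S\<close> either \<open>p\<close> exceeds 1/2 or \<open>q\<close> is
      1, so \<open>f\<close> is 1 there. On \<open>F\<close> the function \<open>q\<close> vanishes,
      so \<open>f\<close> extends to \<open>Y\<close> through \<open>h\<close>.\<close>
    define f where "f z = min 1 (2 * max (p z) (q z))" for z
    have "continuous_map X euclideanreal f"
      unfolding f_def using pc qc by (intro continuous_intros) auto
    moreover have "f ` topspace X \<subseteq> {0..1}"
      using q01 by (auto simp: f_def min_def max_def)
    ultimately have "continuous_map X ?I f" unfolding continuous_map_real_interval_iff by blast
    moreover have "continuous_map Y euclideanreal (\<lambda>y. min 1 (2 * h y))"
      using hc by (intro continuous_intros) auto
    then have "continuous_map Y ?I (\<lambda>y. min 1 (2 * h y))"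
      using h01 unfolding continuous_map_real_interval_iff by auto
    moreover have "min 1 (2 * h (i z)) = f z" if "z \<in> F" for z
    proof -
      have "h (i z) \<in> {0..1}" using that h01 iF by blast
      moreover have "q z = 0" using that q(2) by blast
      ultimately show ?thesis using p(2) that by (simp add: f_def)
    qed
    ultimately have "f \<in> B" unfolding B_def by blast
    moreover have "f x = 0"
      using True h(2) p(2) q(2) by (auto simp: f_def)
    moreover have "f z = 1" if "z \<in> S" for z
    proof (cases "p z \<le> 1/2")
      case True
      then have "q z = 1" using q(3) that closedin_subset[OF S] by (auto simp: C_def)
      then show ?thesis by (simp add: f_def)
    qed (simp add: f_def)
    ultimately show ?thesis by blast
  qed
  let ?T = "product_topology (\<lambda>f. ?I) B"
  define e where "e x = (\<lambda>f\<in>B. f x)" for x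
  define Z where "Z = subtopology ?T (?T closure_of (e ` topspace X))"
  have e: "embedding_map X ?T e"
    unfolding e_def by (rule cube_embedding) (use sep X'(2) in \<open>auto simp: B_def\<close>)
  have Z: "compactification X Z e"
    unfolding Z_def by (rule compactification_closure_of[OF e compact_Hausdorff_cube])
  have "\<forall>f\<in>B. \<exists>h. continuous_map Y ?I h \<and> (\<forall>x\<in>F. h (i x) = f x)" by (simp add: B_def)
  from bchoice[OF this] obtain h
    where h: "\<forall>f\<in>B. continuous_map Y ?I (h f) \<and> (\<forall>x\<in>F. h f (i x) = f x)" by blast
  \<comment> \<open>The chosen extensions serve as coordinates, which makes \<open>g\<close> extend
    \<open>e\<close> from \<open>F\<close> along \<open>i\<close>.\<close>
  define g where "g y = (\<lambda>f\<in>B. h f y)" for y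
  have gT: "continuous_map Y ?T g"
    unfolding continuous_map_componentwise
  proof (intro conjI ballI)
    show "continuous_map Y ?I (\<lambda>y. g y f)" if "f \<in> B" for f
      using h that by (simp add: g_def)
  qed (auto simp: g_def)
  have gi: "g (i x) = e x" if "x \<in> F" for x
    unfolding g_def e_def using h that by (intro restrict_ext) blast
  have gF: "g ` topspace Y \<subseteq> ?T closure_of (e ` F)"
  proof -
    have "g ` i ` F = e ` F" using gi by (auto simp: image_image)
    then show ?thesis using continuous_map_image_closure_subset[OF gT, of "i ` F"] i(2) by simp
  qed
  moreover have "?T closure_of (e ` F) \<subseteq> ?T closure_of (e ` topspace X)"
    using FX by (intro closure_of_mono image_mono)
  ultimately have g: "continuous_map Y Z g"
    using gT by (auto simp: Z_def continuous_map_in_subtopology)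
  have inj: "y = y'" if yy: "y \<in> topspace Y" "y' \<in> topspace Y" "g y = g y'" for y y'
  proof (rule ccontr)
    assume "y \<noteq> y'"
    then have "closedin Y {y'}" "y \<in> topspace Y - {y'}"
      using closedin_Hausdorff_singleton[OF Y'(2)] yy by auto
    then obtain k where k: "continuous_map Y ?I k" "k y = 0" "k ` {y'} \<subseteq> {1}"
      using Y'(1) unfolding completely_regular_space_def by blast
    obtain f where f: "continuous_map X ?I f" "\<forall>x\<in>F. f x = k (i x)" using extend[OF k(1)] by blast
    then have fB: "f \<in> B" unfolding B_def using k(1) by auto
    have "h f z = k z" if "z \<in> topspace Y" for z
    proof (rule forall_in_closure_of_eq[where X = Y and S = "i ` F" and Y = ?I and f = "h f" and g = k])
      show "z \<in> Y closure_of (i ` F)" using that i(2) by simp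
      show "continuous_map Y ?I (h f)" using h fB by blast
      show "h f w = k w" if "w \<in> i ` F" for w using that h fB f(2) by auto
    qed (auto simp: k(1) Hausdorff_space_subtopology)
    moreover have "h f y = h f y'" using fun_cong[OF yy(3), of f] fB by (simp add: g_def)
    ultimately have "k y = k y'" using yy(1,2) by simp
    then show False using k(2,3) by simp
  qed
  have "y \<in> i ` F" if y: "y \<in> topspace Y" and ge: "g y \<in> e ` topspace X" for y
  proof -
    obtain x where x: "x \<in> topspace X" "g y = e x" using ge by blast
    have "e x \<in> ?T closure_of (e ` F)" using gF y x(2) by (metis image_subset_iff)
    then have "x \<in> F" using closed_set_trace_embedding[OF e F x(1)] by blast
    then have "y = i x" using inj[OF y] iF gi x(2) by (metis image_subset_iff)
    then show ?thesis using \<open>x \<in> F\<close> by blast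
  qed
  then have "{y \<in> topspace Y. g y \<in> e ` topspace X} = i ` F"
    using iF gi FX by auto
  then show thesis using that Z g by blast
qed

section \<open>Closed subspaces of absolute spaces\<close>

lemma compactification_tychonoff_space:
  "compactification X Z e \<Longrightarrow> tychonoff_space Z"
  unfolding compactification_def tychonoff_space_def
  by (meson Hausdorff_imp_t1_space compact_Hausdorff_or_regular_imp_normal_space
      normal_imp_completely_regular_space_A)

text \<open>Absoluteness enters twice: in some compactification, to make \<open>X\<close> normal,
  and then in the compactification \<open>Z\<close> built from \<open>Y\<close>, where the class of
  \<open>X\<close> is pulled back along \<open>g\<close>.\<close>

lemma absolute_C_space_F_class_closed_subspace:
  assumes X: "tychonoff_space X" and F: "closedin X F" and abs: "absolute_C_space (F_class \<alpha>) X"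
  shows "absolute_C_space (F_class \<alpha>) (subtopology X F)"
  unfolding absolute_C_space_def
proof (intro allI impI)
  fix Y :: "'a set set topology" and i
  assume Y: "tychonoff_space Y \<and> dense_embedding (subtopology X F) Y i"
  have mem: "e ` topspace X \<in> F_class \<alpha> Z" if "compactification X Z e"
    for Z :: "(('a \<Rightarrow> real) \<Rightarrow> real) topology" and e
    using absolute_C_space_F_class_any_type[OF abs compactification_tychonoff_space[OF that]] that
    by (simp add: compactification_def)
  obtain Z0 :: "(('a \<Rightarrow> real) \<Rightarrow> real) topology" and e0 where Z0: "compactification X Z0 e0"
    using tychonoff_compactification[OF X] by blast
  have normal: "normal_space X"
    using F_class_compactification_imp_normal_space[OF Z0 mem[OF Z0] X] .
  obtain Z :: "(('a \<Rightarrow> real) \<Rightarrow> real) topology" and e g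
    where Z: "compactification X Z e" "continuous_map Y Z g"
      "{y \<in> topspace Y. g y \<in> e ` topspace X} = i ` F"
    by (rule compactification_extending_closed_subspace
        [OF normal X F conjunct1[OF Y] conjunct2[OF Y]])
  have "topspace (subtopology X F) = F" using closedin_subset[OF F] by auto
  then show "i ` topspace (subtopology X F) \<in> F_class \<alpha> Y"
    using F_class_continuous_preimage[OF Z(2) mem[OF Z(1)]] Z(3) by simp
qed

text \<open>A compactification is itself a Tychonoff space in which \<open>X\<close> is dense. The
  one built in a cube lives on another type, whence the two transfers between types.\<close>

lemma absolute_C_space_imp_C_space_mult_class:
  fixes X :: "'a topology"
  assumes "tychonoff_space X" "absolute_C_space (mult_class \<alpha>) X"
  shows "C_space (mult_class \<alpha>) X"
proof -
  obtain Z :: "(('a \<Rightarrow> real) \<Rightarrow> real) topology" and e where Z: "compactification X Z e"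
    using tychonoff_compactification[OF assms(1)] by blast
  then have "dense_embedding X Z e" by (simp add: compactification_def)
  with assms(2) compactification_tychonoff_space[OF Z]
  have "e ` topspace X \<in> mult_class \<alpha> Z" by (rule absolute_C_space_mult_class_any_type)
  with Z show ?thesis by (rule C_space_mult_class_any_type)
qed

lemma absolute_C_space_imp_C_space_add_class:
  fixes X :: "'a topology"
  assumes "tychonoff_space X" "absolute_C_space (add_class \<alpha>) X"
  shows "C_space (add_class \<alpha>) X"
proof -
  obtain Z :: "(('a \<Rightarrow> real) \<Rightarrow> real) topology" and e where Z: "compactification X Z e"
    using tychonoff_compactification[OF assms(1)] by blast
  then have "dense_embedding X Z e" by (simp add: compactification_def)
  with assms(2) compactification_tychonoff_space[OF Z]
  have "e ` topspace X \<in> add_class \<alpha> Z" by (rule absolute_C_space_add_class_any_type)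
  with Z show ?thesis by (rule C_space_add_class_any_type)
qed

theorem proposition3p4:
  fixes X :: "'a topology" and F :: "'a set"
    and \<C> :: "'a set set topology \<Rightarrow> 'a set set set set"
  assumes "(\<exists>\<alpha>\<ge>1. \<C> = F_class \<alpha>) \<or> (\<exists>\<alpha>. \<C> = mult_class \<alpha>) \<or> (\<exists>\<alpha>. \<C> = add_class \<alpha>)"
    and "tychonoff_space X" and "closedin X F"
  shows "(C_space \<C> X \<longrightarrow> C_space \<C> (subtopology X F)) \<and>
    (absolute_C_space \<C> X \<longrightarrow> absolute_C_space \<C> (subtopology X F))"
proof -
  have preimage: "{y \<in> topspace Y. g y \<in> S} \<in> \<C> Y" if "continuous_map Y Z g" "S \<in> \<C> Z" for Y Z g S
    using assms(1) that
    by (elim disjE exE conjE)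
      (simp_all add: F_class_continuous_preimage mult_add_class_continuous_preimage)
  have sub: "C_space \<C> (subtopology X F)" if "C_space \<C> X"
    using preimage that assms(3) by (rule C_space_closed_subspace)
  \<comment> \<open>For the Borel classes the absolute statement reduces to the first one: an
    absolute space is a \<C> space, its closed subspace is again one, and countable determination
    makes that subspace absolute.\<close>
  have abs: "absolute_C_space \<C> (subtopology X F)"
    if "\<And>K S. S \<in> \<C> K \<Longrightarrow> countably_determined K \<C> S" "C_space \<C> X"
    using C_space_imp_absolute_C_space that sub by blast
  have "absolute_C_space \<C> (subtopology X F)" if a: "absolute_C_space \<C> X"
    using assms(1)
  proof (elim disjE exE conjE)
    fix \<alpha> assume "\<C> = F_class \<alpha>"
    then show ?thesis using absolute_C_space_F_class_closed_subspace assms(2,3) a by blast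
  next
    fix \<alpha> assume \<C>: "\<C> = mult_class \<alpha>"
    show ?thesis
    proof (rule abs)
      show "C_space \<C> X"
        using absolute_C_space_imp_C_space_mult_class[OF assms(2)] a unfolding \<C> by blast
    qed (use countably_determined_mult_add_class \<C> in blast)
  next
    fix \<alpha> assume \<C>: "\<C> = add_class \<alpha>"
    show ?thesis
    proof (rule abs)
      show "C_space \<C> X"
        using absolute_C_space_imp_C_space_add_class[OF assms(2)] a unfolding \<C> by blast
    qed (use countably_determined_mult_add_class \<C> in blast)
  qed
  with sub show ?thesis by blast
qed

end
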